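(* Let $G$ be a group, $k$ a field, $B$ a $kG$-Hopf bimodule, and let $C$ be the cotensor coalgebra over $kG$ of the bicomodule $B$, endowed with its Hopf algebra structure. Choose a basis of each isotypic component of the bicomodule $B$ and identify the coalgebra $C$ with the path coalgebra of the quiver of $B$. Let $\alpha$ and $\beta$ be paths of length $n$ and $m$ respectively. Then the product of $\alpha$ and $\beta$ in $C$ is $$\alpha.\beta=\sum_{d\in D_n^{n+m}}(\alpha.\beta)_d .$$
   Context: A quiver has a set of vertices, a set of arrows (both possibly infinite), and source and terminus maps $s,t$ from arrows to vertices. A path of length $n\ge1$ is a sequence $a_n\cdots a_1$ of arrows with $t(a_i)=s(a_{i+1})$, with source $s(a_1)$ and terminus $t(a_n)$; vertices are the paths of length $0$, each equal to its own source and terminus. The path coalgebra $kQ$ of a quiver $Q$ has the paths as $k$-basis, with $\Delta\alpha=\sum_{\alpha=\alpha_{(2)}\alpha_{(1)}}\alpha_{(2)}\otimes\alpha_{(1)}$ (sum over all splits of $\alpha$ as a concatenation of two paths), $\varepsilon(u)=1$ for vertices $u$ and $\varepsilon(\alpha)=0$ for paths of positive length. $Q_p$ denotes the set of paths of length $p$. A $kG$-Hopf bimodule $B$ is a $kG$-bimodule and $kG$-bicomodule, with coactions $\delta_L:B\to kG\otimes B$ and $\delta_R:B\to B\otimes kG$ that are $kG$-bimodule maps (for the diagonal actions). Its isotypic components are ${}^yB^x=\{b\in B:\delta_L(b)=y\otimes b,\ \delta_R(b)=b\otimes x\}$ for $x,y\in G$; $B$ is their direct sum, and $g.({}^yB^x)={}^{gy}B^{gx}$,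 $({}^yB^x).g={}^{yg}B^{xg}$ for $g\in G$. The quiver $Q$ of $B$ (with a chosen basis of each ${}^yB^x$) has vertex set $G$, and its arrows from $x$ to $y$ are the elements of the chosen basis of ${}^yB^x$. Thus $kQ_0=kG$, $kQ_1=B$, and the $p$-th cotensor power of $B$ over $kG$ is identified with $kQ_p$, a path $a_p\cdots a_1$ corresponding to $a_p\otimes\cdots\otimes a_1$; so the cotensor coalgebra $C=kG\oplus B\oplus(B\,\square_{kG}B)\oplus\cdots$ is identified with $kQ$. If $x_i\in{}^{g_{i}}B^{g_{i-1}}$ for $i=1,\dots,p$, write $[x_p]\cdots[x_1]$ for the element $x_p\otimes\cdots\otimes x_1$ of the $p$-th cotensor power, i.e. the multilinear extension of concatenation of arrows. The Hopf algebra structure on $C$: the multiplication is the unique coalgebra map $\varphi:C\otimes C\to C$ whose component $\varphi_0:C\otimes C\to kG$ is the projection to $kG\otimes kG$ followed by the multiplication of $kG$, and whose component $\varphi_1:C\otimes C\to B$ is the projection to $(kG\otimes B)\oplus(B\otimes kG)$ followed by the left and right actions of $kG$ on $B$. Thin splits: for $0\le n\le p$, let $D_n^p$ be the set of sequences $d=(d_p,\dots,d_1)$ of zeros and ones with exactly $n$ ones. For an $n$-path $\alpha$ (with arrows $a_n,\dots,a_1$ if $n\ge1$) and $d\in D_n^p$, the $p$-thin split $d\alpha=((d\alpha)_p,\dots,(d\alpha)_1)$ is the unique sequence of vertices and arrows whose concatenation $(d\alpha)_p\cdots(d\alpha)_1$ in the path algebra sense is $\alpha$ and such that $(d\alpha)_i$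 is a vertex if $d_i=0$ and an arrow if $d_i=1$. (Explicitly, if $j$ is the number of ones among $d_1,\dots,d_{i-1}$: when $d_i=1$, $(d\alpha)_i=a_{j+1}$; when $d_i=0$, $(d\alpha)_i$ is $s(\alpha)$ if $j=0$ and $t(a_j)$ if $j\ge1$.) For an $n$-path $\alpha$, an $m$-path $\beta$ and $d\in D_n^{n+m}$, let $\bar d\in D_m^{n+m}$ be obtained from $d$ by exchanging zeros and ones, and set $$(\alpha.\beta)_d=[(d\alpha)_{m+n}.(\bar d\beta)_{m+n}]\cdots[(d\alpha)_1.(\bar d\beta)_1],$$ where, if $d_i=1$, $(d\alpha)_i.(\bar d\beta)_i$ is the right action of the group element $(\bar d\beta)_i$ on the arrow $(d\alpha)_i$, and if $d_i=0$ it is the left action of the group element $(d\alpha)_i$ on the arrow $(\bar d\beta)_i$. The factors are concatenated, so this is an element of the $(m+n)$-th cotensor power of $B$. When $n=m=0$ (so that $d$ is the empty sequence) $(\alpha.\beta)_d$ is understood as the product $\alpha\beta$ in $G$. *)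

theory Defs
  imports
    "HOL-Library.Poly_Mapping"
    "HOL-Library.FuncSet"
    "Graph_Theory.Arc_Walk"
begin

section \<open>Free vector spaces\<close>

text \<open>
  The type \<^typ>\<open>'a \<Rightarrow>\<^sub>0 'k\<close> is the vector space over \<^typ>\<open>'k\<close> with basis \<^typ>\<open>'a\<close>; more generally
  \<^typ>\<open>'a \<Rightarrow>\<^sub>0 'b\<close> is the tensor product of the free space on \<^typ>\<open>'a\<close> with a vector space \<^typ>\<open>'b\<close>,
  with \<open>single a b\<close> standing for \<open>a \<otimes> b\<close>.  The tensor product of the free spaces on
  \<^typ>\<open>'a\<close> and \<^typ>\<open>'c\<close> is the free space on \<^typ>\<open>'a \<times> 'c\<close>.

  For a group written additively, but not assumed commutative (class \<^class>\<open>group_add\<close>),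
  \<^typ>\<open>'g \<Rightarrow>\<^sub>0 'k\<close> with the convolution product of the library is the group algebra.
\<close>

abbreviation single :: "'a \<Rightarrow> 'b::zero \<Rightarrow> 'a \<Rightarrow>\<^sub>0 'b" where
  "single \<equiv> Poly_Mapping.single"

definition pm_scale :: "('k \<Rightarrow> 'b \<Rightarrow> 'b) \<Rightarrow> 'k \<Rightarrow> ('a \<Rightarrow>\<^sub>0 'b::zero) \<Rightarrow> ('a \<Rightarrow>\<^sub>0 'b)" where
  "pm_scale s c = Poly_Mapping.map (s c)"

definition pm_lin :: "('a \<Rightarrow> 'b \<Rightarrow> 'c::comm_monoid_add) \<Rightarrow> ('a \<Rightarrow>\<^sub>0 'b::zero) \<Rightarrow> 'c" where
  "pm_lin F x = (\<Sum>a\<in>Poly_Mapping.keys x. F a (Poly_Mapping.lookup x a))"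

definition free_on :: "'a set \<Rightarrow> ('a \<Rightarrow>\<^sub>0 'k::zero) set" where
  "free_on X = {x. Poly_Mapping.keys x \<subseteq> X}"

definition linear_on_free :: "'a set \<Rightarrow> (('a \<Rightarrow>\<^sub>0 'k::field) \<Rightarrow> ('c \<Rightarrow>\<^sub>0 'k)) \<Rightarrow> bool" where
  "linear_on_free X f \<longleftrightarrow>
     (\<forall>x\<in>free_on X. \<forall>y\<in>free_on X. f (x + y) = f x + f y) \<and>
     (\<forall>c. \<forall>x\<in>free_on X. f (pm_scale (*) c x) = pm_scale (*) c (f x))"

definition tensor :: "('a \<Rightarrow>\<^sub>0 'k::field) \<Rightarrow> ('c \<Rightarrow>\<^sub>0 'k) \<Rightarrow> ('a \<times> 'c \<Rightarrow>\<^sub>0 'k)" where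
  "tensor x y = pm_lin (\<lambda>a r. pm_lin (\<lambda>b s. single (a, b) (r * s)) y) x"

definition tensor_map ::
  "(('a \<Rightarrow>\<^sub>0 'k::field) \<Rightarrow> ('c \<Rightarrow>\<^sub>0 'k)) \<Rightarrow> (('b \<Rightarrow>\<^sub>0 'k) \<Rightarrow> ('d \<Rightarrow>\<^sub>0 'k)) \<Rightarrow>
   ('a \<times> 'b \<Rightarrow>\<^sub>0 'k) \<Rightarrow> ('c \<times> 'd \<Rightarrow>\<^sub>0 'k)" where
  "tensor_map f f' =
     pm_lin (\<lambda>(a, b) r. pm_scale (*) r (tensor (f (single a 1)) (f' (single b 1))))"

definition middle_swap :: "(('a \<times> 'b) \<times> ('c \<times> 'd) \<Rightarrow>\<^sub>0 'k::field) \<Rightarrow> (('a \<times> 'c) \<times> ('b \<times> 'd) \<Rightarrow>\<^sub>0 'k)" where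
  "middle_swap = pm_lin (\<lambda>((a, b), (c, d)) r. single ((a, c), (b, d)) r)"


section \<open>Coalgebras on free vector spaces\<close>

definition tensor_comult ::
  "(('a \<Rightarrow>\<^sub>0 'k::field) \<Rightarrow> ('a \<times> 'a \<Rightarrow>\<^sub>0 'k)) \<Rightarrow> (('c \<Rightarrow>\<^sub>0 'k) \<Rightarrow> ('c \<times> 'c \<Rightarrow>\<^sub>0 'k)) \<Rightarrow>
   ('a \<times> 'c \<Rightarrow>\<^sub>0 'k) \<Rightarrow> (('a \<times> 'c) \<times> ('a \<times> 'c) \<Rightarrow>\<^sub>0 'k)" where
  "tensor_comult \<Delta> \<Delta>' z = middle_swap (tensor_map \<Delta> \<Delta>' z)"

definition tensor_counit ::
  "(('a \<Rightarrow>\<^sub>0 'k::field) \<Rightarrow> 'k) \<Rightarrow> (('c \<Rightarrow>\<^sub>0 'k) \<Rightarrow> 'k) \<Rightarrow> ('a \<times> 'c \<Rightarrow>\<^sub>0 'k) \<Rightarrow> 'k" where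
  "tensor_counit \<epsilon> \<epsilon>' = pm_lin (\<lambda>(a, b) r. r * \<epsilon> (single a 1) * \<epsilon>' (single b 1))"

text \<open>
  Maps out of \<open>free_on X\<close> are taken to be extensional (undefined outside \<open>free_on X\<close>),
  so that they are determined by their values on \<open>free_on X\<close>.
\<close>

definition coalgebra_map ::
  "'a set \<Rightarrow> (('a \<Rightarrow>\<^sub>0 'k::field) \<Rightarrow> ('a \<times> 'a \<Rightarrow>\<^sub>0 'k)) \<Rightarrow> (('a \<Rightarrow>\<^sub>0 'k) \<Rightarrow> 'k) \<Rightarrow>
   'c set \<Rightarrow> (('c \<Rightarrow>\<^sub>0 'k) \<Rightarrow> ('c \<times> 'c \<Rightarrow>\<^sub>0 'k)) \<Rightarrow> (('c \<Rightarrow>\<^sub>0 'k) \<Rightarrow> 'k) \<Rightarrow>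
   (('a \<Rightarrow>\<^sub>0 'k) \<Rightarrow> ('c \<Rightarrow>\<^sub>0 'k)) \<Rightarrow> bool" where
  "coalgebra_map X \<Delta> \<epsilon> Y \<Delta>' \<epsilon>' f \<longleftrightarrow>
     f \<in> free_on X \<rightarrow>\<^sub>E free_on Y \<and> linear_on_free X f \<and>
     (\<forall>z\<in>free_on X. \<Delta>' (f z) = tensor_map f f (\<Delta> z)) \<and>
     (\<forall>z\<in>free_on X. \<epsilon>' (f z) = \<epsilon> z)"


section \<open>Hopf bimodules over a group algebra\<close>

text \<open>
  Both \<open>kG \<otimes> B\<close> and \<open>B \<otimes> kG\<close> are modelled by \<^typ>\<open>'g \<Rightarrow>\<^sub>0 'b\<close>, with \<open>single g b\<close> standing for
  \<open>g \<otimes> b\<close> and \<open>b \<otimes> g\<close> respectively.  In this model the diagonal left action of \<open>kG\<close> is given by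
  the same formula on both, and likewise the diagonal right action.
\<close>

definition diag_left ::
  "(('g::group_add \<Rightarrow>\<^sub>0 'k::field) \<Rightarrow> 'b \<Rightarrow> 'b::ab_group_add) \<Rightarrow> ('g \<Rightarrow>\<^sub>0 'k) \<Rightarrow> ('g \<Rightarrow>\<^sub>0 'b) \<Rightarrow> ('g \<Rightarrow>\<^sub>0 'b)" where
  "diag_left lact a x =
     pm_lin (\<lambda>g c. pm_lin (\<lambda>h b. single (g + h) (lact (single g c) b)) x) a"

definition diag_right ::
  "('b \<Rightarrow> ('g::group_add \<Rightarrow>\<^sub>0 'k::field) \<Rightarrow> 'b::ab_group_add) \<Rightarrow> ('g \<Rightarrow>\<^sub>0 'b) \<Rightarrow> ('g \<Rightarrow>\<^sub>0 'k) \<Rightarrow> ('g \<Rightarrow>\<^sub>0 'b)" where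
  "diag_right ract x a =
     pm_lin (\<lambda>g c. pm_lin (\<lambda>h b. single (h + g) (ract b (single g c))) x) a"

locale hopf_bimodule = vector_space scale
  for scale :: "'k::field \<Rightarrow> 'b::ab_group_add \<Rightarrow> 'b" +
  fixes lact :: "('g::group_add \<Rightarrow>\<^sub>0 'k) \<Rightarrow> 'b \<Rightarrow> 'b"
    and ract :: "'b \<Rightarrow> ('g \<Rightarrow>\<^sub>0 'k) \<Rightarrow> 'b"
    and \<delta>\<^sub>L :: "'b \<Rightarrow> ('g \<Rightarrow>\<^sub>0 'b)"
    and \<delta>\<^sub>R :: "'b \<Rightarrow> ('g \<Rightarrow>\<^sub>0 'b)"
  assumes lact_add_left: "lact (a + a') b = lact a b + lact a' b"
    and lact_add_right: "lact a (b + b') = lact a b + lact a b'"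
    and lact_mult: "lact (a * a') b = lact a (lact a' b)"
    and lact_scalar: "lact (single 0 c) b = scale c b"
    and ract_add_left: "ract (b + b') a = ract b a + ract b' a"
    and ract_add_right: "ract b (a + a') = ract b a + ract b a'"
    and ract_mult: "ract b (a * a') = ract (ract b a) a'"
    and ract_scalar: "ract b (single 0 c) = scale c b"
    and bimodule: "ract (lact a b) a' = lact a (ract b a')"
    and linear_left_coaction: "Vector_Spaces.linear scale (pm_scale scale) \<delta>\<^sub>L"
    and linear_right_coaction: "Vector_Spaces.linear scale (pm_scale scale) \<delta>\<^sub>R"
    \<comment> \<open>\<open>(\<Delta> \<otimes> id) \<circ> \<delta>\<^sub>L = (id \<otimes> \<delta>\<^sub>L) \<circ> \<delta>\<^sub>L\<close>, with \<open>single (g, h) b\<close> for \<open>g \<otimes> h \<otimes> b\<close>\<close>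
    and left_coassoc:
      "pm_lin (\<lambda>g b'. single (g, g) b') (\<delta>\<^sub>L b) =
       pm_lin (\<lambda>g b'. pm_lin (\<lambda>h b''. single (g, h) b'') (\<delta>\<^sub>L b')) (\<delta>\<^sub>L b)"
    and left_counit: "pm_lin (\<lambda>g b'. b') (\<delta>\<^sub>L b) = b"
    \<comment> \<open>\<open>(id \<otimes> \<Delta>) \<circ> \<delta>\<^sub>R = (\<delta>\<^sub>R \<otimes> id) \<circ> \<delta>\<^sub>R\<close>, with \<open>single (g, h) b\<close> for \<open>b \<otimes> g \<otimes> h\<close>\<close>
    and right_coassoc:
      "pm_lin (\<lambda>h b'. single (h, h) b') (\<delta>\<^sub>R b) =
       pm_lin (\<lambda>h b'. pm_lin (\<lambda>g b''. single (g, h) b'') (\<delta>\<^sub>R b')) (\<delta>\<^sub>R b)"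
    and right_counit: "pm_lin (\<lambda>g b'. b') (\<delta>\<^sub>R b) = b"
    \<comment> \<open>\<open>(id \<otimes> \<delta>\<^sub>R) \<circ> \<delta>\<^sub>L = (\<delta>\<^sub>L \<otimes> id) \<circ> \<delta>\<^sub>R\<close>, with \<open>single (g, h) b\<close> for \<open>g \<otimes> b \<otimes> h\<close>\<close>
    and bicomodule:
      "pm_lin (\<lambda>g b'. pm_lin (\<lambda>h b''. single (g, h) b'') (\<delta>\<^sub>R b')) (\<delta>\<^sub>L b) =
       pm_lin (\<lambda>h b'. pm_lin (\<lambda>g b''. single (g, h) b'') (\<delta>\<^sub>L b')) (\<delta>\<^sub>R b)"
    and left_coaction_lact: "\<delta>\<^sub>L (lact a b) = diag_left lact a (\<delta>\<^sub>L b)"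
    and left_coaction_ract: "\<delta>\<^sub>L (ract b a) = diag_right ract (\<delta>\<^sub>L b) a"
    and right_coaction_lact: "\<delta>\<^sub>R (lact a b) = diag_left lact a (\<delta>\<^sub>R b)"
    and right_coaction_ract: "\<delta>\<^sub>R (ract b a) = diag_right ract (\<delta>\<^sub>R b) a"

definition isotypic ::
  "('b \<Rightarrow> ('g \<Rightarrow>\<^sub>0 'b)) \<Rightarrow> ('b \<Rightarrow> ('g \<Rightarrow>\<^sub>0 'b)) \<Rightarrow> 'g \<Rightarrow> 'g \<Rightarrow> 'b::ab_group_add set" where
  "isotypic \<delta>\<^sub>L \<delta>\<^sub>R y x = {b. \<delta>\<^sub>L b = single y b \<and> \<delta>\<^sub>R b = single x b}"

definition isotypic_bases ::
  "('k::field \<Rightarrow> 'b \<Rightarrow> 'b) \<Rightarrow> ('b \<Rightarrow> ('g \<Rightarrow>\<^sub>0 'b)) \<Rightarrow> ('b \<Rightarrow> ('g \<Rightarrow>\<^sub>0 'b)) \<Rightarrow>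
   ('g \<Rightarrow> 'g \<Rightarrow> 'b::ab_group_add set) \<Rightarrow> bool" where
  "isotypic_bases scale \<delta>\<^sub>L \<delta>\<^sub>R E \<longleftrightarrow>
     (\<forall>y x. \<not> module.dependent scale (E y x) \<and>
            module.span scale (E y x) = isotypic \<delta>\<^sub>L \<delta>\<^sub>R y x)"


section \<open>Quivers, paths and the path coalgebra\<close>

text \<open>
  A quiver is a \<^locale>\<open>wf_digraph\<close>.  A path \<open>a\<^sub>n \<cdots> a\<^sub>1\<close> is a pair of its source and the list
  \<open>[a\<^sub>1, \<dots>, a\<^sub>n]\<close>; the list is in order of traversal, so it is the reverse of the
  usual right-to-left notation.  A vertex \<open>u\<close>, as a path of length zero, is \<open>(u, [])\<close>.
\<close>

type_synonym ('v, 'a) path = "'v \<times> 'a list"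

definition paths :: "('v, 'a) pre_digraph \<Rightarrow> ('v, 'a) path set" where
  "paths Q = {(u, p). \<exists>v. pre_digraph.awalk Q u p v}"

definition paths_of_length :: "('v, 'a) pre_digraph \<Rightarrow> nat \<Rightarrow> ('v, 'a) path set" where
  "paths_of_length Q n = {\<alpha> \<in> paths Q. length (snd \<alpha>) = n}"

definition target :: "('v, 'a) pre_digraph \<Rightarrow> ('v, 'a) path \<Rightarrow> 'v" where
  "target Q \<alpha> = pre_digraph.awlast Q (fst \<alpha>) (snd \<alpha>)"

text \<open>The summand for \<open>i\<close> is the splitting whose first-traversed (right-hand) part has length \<open>i\<close>.\<close>

definition path_comult ::
  "('v, 'a) pre_digraph \<Rightarrow> (('v, 'a) path \<Rightarrow>\<^sub>0 'k::field) \<Rightarrow> (('v, 'a) path \<times> ('v, 'a) path \<Rightarrow>\<^sub>0 'k)" where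
  "path_comult Q =
     pm_lin (\<lambda>(u, p) r. \<Sum>i\<le>length p.
       single ((target Q (u, take i p), drop i p), (u, take i p)) r)"

definition path_counit :: "(('v, 'a) path \<Rightarrow>\<^sub>0 'k::field) \<Rightarrow> 'k" where
  "path_counit = pm_lin (\<lambda>(u, p) r. if p = [] then r else 0)"

text \<open>The path algebra product, that is, the bilinear extension of concatenation.\<close>

definition path_concat ::
  "('v, 'a) pre_digraph \<Rightarrow> (('v, 'a) path \<Rightarrow>\<^sub>0 'k::field) \<Rightarrow> (('v, 'a) path \<Rightarrow>\<^sub>0 'k) \<Rightarrow> (('v, 'a) path \<Rightarrow>\<^sub>0 'k)" where
  "path_concat Q x y =
     pm_lin (\<lambda>\<alpha> r. pm_lin (\<lambda>\<beta> s.
       if fst \<alpha> = target Q \<beta> then single (fst \<beta>, snd \<beta> @ snd \<alpha>) (r * s) else 0) y) x"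


section \<open>The cotensor coalgebra of a Hopf bimodule as a path coalgebra\<close>

text \<open>
  The argument \<open>E y x\<close> is the chosen basis of the component \<open>\<^sup>yB\<^sup>x\<close>, that is, the set of arrows from
  \<open>x\<close> to \<open>y\<close>.  As the components are independent, their bases are disjoint, so tail and head
  are determined by the arrow.
\<close>

definition quiver :: "('g \<Rightarrow> 'g \<Rightarrow> 'b set) \<Rightarrow> ('g, 'b) pre_digraph" where
  "quiver E =
     \<lparr>verts = UNIV, arcs = (\<Union>y x. E y x),
      tail = (\<lambda>a. THE x. \<exists>y. a \<in> E y x), head = (\<lambda>a. THE y. \<exists>x. a \<in> E y x)\<rparr>"

lemma wf_digraph_quiver: "wf_digraph (quiver E)"
  by unfold_locales (simp_all add: quiver_def)

subsection \<open>Identification of the cotensor powers with \<open>kQ\<^sub>p\<close>\<close>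

lemma lookup_pm_lin:
  "Poly_Mapping.lookup (pm_lin F x) k = (\<Sum>a\<in>Poly_Mapping.keys x. Poly_Mapping.lookup (F a (Poly_Mapping.lookup x a)) k)"
  by (simp add: pm_lin_def lookup_sum)

lemma pm_lin_superset:
  assumes "finite S" "Poly_Mapping.keys x \<subseteq> S" "\<And>a. F a 0 = 0"
  shows "pm_lin F x = (\<Sum>a\<in>S. F a (Poly_Mapping.lookup x a))"
  unfolding pm_lin_def by (rule sum.mono_neutral_left) (use assms in \<open>auto simp: in_keys_iff\<close>)

lemma pm_lin_single: "F a 0 = 0 \<Longrightarrow> pm_lin F (single a c) = F a c"
  by (simp add: pm_lin_def)

lemma pm_lin_add:
  assumes "\<And>a. F a 0 = 0" "\<And>a c c'. F a (c + c') = F a c + F a c'"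
  shows "pm_lin F (x + y) = pm_lin F x + pm_lin F y"
proof -
  let ?S = "Poly_Mapping.keys x \<union> Poly_Mapping.keys y"
  have "Poly_Mapping.keys (x + y) \<subseteq> ?S" by (rule Poly_Mapping.keys_add)
  then show ?thesis
    using assms pm_lin_superset[of ?S x F] pm_lin_superset[of ?S y F] pm_lin_superset[of ?S "x + y" F]
    by (simp add: lookup_add sum.distrib)
qed

lemma pm_lin_sum_single:
  assumes "\<And>a. F a 0 = 0" "\<And>a c c'. F a (c + c') = F a c + F a c'"
  shows "pm_lin F (\<Sum>i\<in>I. single (a i) (c i)) = (\<Sum>i\<in>I. F (a i) (c i))"
proof (induction I rule: infinite_finite_induct)
  case (insert i I)
  then show ?case by (simp add: pm_lin_add[OF assms] pm_lin_single assms(1))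
qed (simp_all add: pm_lin_def)

lemma lookup_pm_scale: "s c 0 = 0 \<Longrightarrow> Poly_Mapping.lookup (pm_scale s c x) a = s c (Poly_Mapping.lookup x a)"
  unfolding pm_scale_def by (transfer) (auto simp: when_def)

lemma sum_delta_keys:
  fixes f :: "'a \<Rightarrow> 'b::comm_monoid_add" and x :: "'a \<Rightarrow>\<^sub>0 'c::zero"
  assumes "Poly_Mapping.lookup x g = 0 \<Longrightarrow> f g = 0"
  shows "(\<Sum>a\<in>Poly_Mapping.keys x. if a = g then f a else 0) = f g"
  using assms by (auto simp: sum.delta in_keys_iff)

lemma lookup_pair_sum:
  fixes f :: "'b::ab_group_add \<Rightarrow> ('g \<Rightarrow>\<^sub>0 'b)"
  assumes "f 0 = 0"
  shows "Poly_Mapping.lookup (pm_lin (\<lambda>g b'. pm_lin (\<lambda>h b''. single (g, h) b'') (f b')) x) (g, h) =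
    Poly_Mapping.lookup (f (Poly_Mapping.lookup x g)) h"
proof -
  have "Poly_Mapping.lookup (pm_lin (\<lambda>h b''. single (g', h) b'') y) (g, h) =
     (if g' = g then Poly_Mapping.lookup y h else 0)" for g' and y :: "'g \<Rightarrow>\<^sub>0 'b"
    unfolding lookup_pm_lin lookup_single when_def
    using sum_delta_keys[of y h "\<lambda>a. Poly_Mapping.lookup y a"] by (cases "g' = g") auto
  then show ?thesis
    unfolding lookup_pm_lin[of _ x]
    using sum_delta_keys[of x g "\<lambda>a. Poly_Mapping.lookup (f (Poly_Mapping.lookup x a)) h"] assms by simp
qed

lemma lookup_pair_sum':
  fixes f :: "'b::ab_group_add \<Rightarrow> ('g \<Rightarrow>\<^sub>0 'b)"
  assumes "f 0 = 0"
  shows "Poly_Mapping.lookup (pm_lin (\<lambda>h b'. pm_lin (\<lambda>g b''. single (g, h) b'') (f b')) x) (g, h) =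
    Poly_Mapping.lookup (f (Poly_Mapping.lookup x h)) g"
proof -
  have "Poly_Mapping.lookup (pm_lin (\<lambda>g b''. single (g, h') b'') y) (g, h) =
     (if h' = h then Poly_Mapping.lookup y g else 0)" for h' and y :: "'g \<Rightarrow>\<^sub>0 'b"
    unfolding lookup_pm_lin lookup_single when_def
    using sum_delta_keys[of y g "\<lambda>a. Poly_Mapping.lookup y a"] by (cases "h' = h") auto
  then show ?thesis
    unfolding lookup_pm_lin[of _ x]
    using sum_delta_keys[of x h "\<lambda>a. Poly_Mapping.lookup (f (Poly_Mapping.lookup x a)) g"] assms by simp
qed

lemma lookup_diag_sum:
  fixes x :: "'g \<Rightarrow>\<^sub>0 'b::ab_group_add"
  shows "Poly_Mapping.lookup (pm_lin (\<lambda>g b'. single (g, g) b') x) (g, h) =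
    (if g = h then Poly_Mapping.lookup x g else 0)"
    unfolding lookup_pm_lin lookup_single when_def
    using sum_delta_keys[of x g "\<lambda>a. Poly_Mapping.lookup x a"] by (cases "g = h") (auto intro!: sum.neutral)

lemma pm_lin_pure: "pm_lin (\<lambda>g b'. b') x = (\<Sum>a\<in>Poly_Mapping.keys x. Poly_Mapping.lookup x a)"
  by (simp add: pm_lin_def)


text \<open>
  A model of \<open>B \<otimes> \<cdots> \<otimes> B\<close> without a choice of basis: \<open>x\<^sub>p \<otimes> \<cdots> \<otimes> x\<^sub>1\<close> is the evaluation of multilinear
  forms at the list \<open>[x\<^sub>1, \<dots>, x\<^sub>p]\<close>.  Over a field this embeds the tensor power into the dual of
  the space of multilinear forms.
\<close>

definition multilinear :: "('k::field \<Rightarrow> 'b::ab_group_add \<Rightarrow> 'b) \<Rightarrow> ('b list \<Rightarrow> 'k) \<Rightarrow> bool" where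
  "multilinear scale f \<longleftrightarrow>
     (\<forall>xs ys x y. f (xs @ (x + y) # ys) = f (xs @ x # ys) + f (xs @ y # ys)) \<and>
     (\<forall>xs ys c x. f (xs @ scale c x # ys) = c * f (xs @ x # ys))"

definition pure_tensor ::
  "('k::field \<Rightarrow> 'b::ab_group_add \<Rightarrow> 'b) \<Rightarrow> 'b list \<Rightarrow> (('b list \<Rightarrow> 'k) \<Rightarrow> 'k)" where
  "pure_tensor scale xs = (\<lambda>f. if multilinear scale f then f xs else 0)"

definition tensor_sum ::
  "('k::field \<Rightarrow> 'b::ab_group_add \<Rightarrow> 'b) \<Rightarrow> ('b list \<Rightarrow>\<^sub>0 'k) \<Rightarrow> (('b list \<Rightarrow> 'k) \<Rightarrow> 'k)" where
  "tensor_sum scale w = (\<lambda>f. pm_lin (\<lambda>xs r. r * pure_tensor scale xs f) w)"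

definition tensor_power ::
  "('k::field \<Rightarrow> 'b::ab_group_add \<Rightarrow> 'b) \<Rightarrow> nat \<Rightarrow> (('b list \<Rightarrow> 'k) \<Rightarrow> 'k) set" where
  "tensor_power scale p = tensor_sum scale ` free_on {xs. length xs = p}"

text \<open>
  The elements on which \<open>\<delta>\<^sub>R\<close> of each factor \<open>x\<^bsub>i+1\<^esub>\<close> agrees with \<open>\<delta>\<^sub>L\<close> of the factor \<open>x\<^sub>i\<close> to its right;
  the two sides lie in \<open>B \<otimes> \<cdots> \<otimes> kG \<otimes> \<cdots> \<otimes> B\<close> and are compared at each basis element \<open>g\<close> of \<open>kG\<close>.
\<close>

definition cotensor_power ::
  "('k::field \<Rightarrow> 'b::ab_group_add \<Rightarrow> 'b) \<Rightarrow> ('b \<Rightarrow> ('g \<Rightarrow>\<^sub>0 'b)) \<Rightarrow> ('b \<Rightarrow> ('g \<Rightarrow>\<^sub>0 'b)) \<Rightarrow> nat \<Rightarrow>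
   (('b list \<Rightarrow> 'k) \<Rightarrow> 'k) set" where
  "cotensor_power scale \<delta>\<^sub>L \<delta>\<^sub>R p =
     {t \<in> tensor_power scale p. \<forall>i g f. Suc i < p \<longrightarrow> multilinear scale f \<longrightarrow>
        t (\<lambda>xs. f (xs[Suc i := Poly_Mapping.lookup (\<delta>\<^sub>R (xs ! Suc i)) g])) =
        t (\<lambda>xs. f (xs[i := Poly_Mapping.lookup (\<delta>\<^sub>L (xs ! i)) g]))}"

definition path_tensor ::
  "('k::field \<Rightarrow> 'b::ab_group_add \<Rightarrow> 'b) \<Rightarrow> (('g, 'b) path \<Rightarrow>\<^sub>0 'k) \<Rightarrow> (('b list \<Rightarrow> 'k) \<Rightarrow> 'k)" where
  "path_tensor scale x = (\<lambda>f. pm_lin (\<lambda>(u, es) r. r * pure_tensor scale es f) x)"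

context hopf_bimodule begin

lemma vector_space_pm_scale: "vector_space (pm_scale scale)"
  by unfold_locales (auto intro!: poly_mapping_eqI simp: lookup_pm_scale lookup_add algebra_simps)

lemma multilinear_sum:
  assumes "multilinear scale f" "finite S"
  shows "f (xs @ (\<Sum>i\<in>S. scale (c i) (v i)) # ys) = (\<Sum>i\<in>S. c i * f (xs @ v i # ys))"
  using assms(2)
proof (induction S rule: finite_induct)
  case empty
  have "f (xs @ scale 0 0 # ys) = 0 * f (xs @ 0 # ys)" using assms(1) unfolding multilinear_def by blast
  then show ?case by simp
next
  case (insert x F)
  then show ?case using assms(1) unfolding multilinear_def by simp
qed

lemma multilinear_Cons: "multilinear scale f \<Longrightarrow> multilinear scale (\<lambda>xs. f (a # xs))"
  unfolding multilinear_def by (metis append_Cons)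

lemma multilinear_update:
  assumes f: "multilinear scale f" and A: "\<And>x y. A (x + y) = A x + A y" "\<And>c x. A (scale c x) = scale c (A x)"
  shows "multilinear scale (\<lambda>xs. f (xs[i := A (xs ! i)]))"
proof -
  have eq: "(xs @ x # ys)[i := A ((xs @ x # ys) ! i)] =
    (if i < length xs then xs[i := A (xs ! i)] @ x # ys
     else if i = length xs then xs @ A x # ys
     else xs @ x # ys[i - length xs - 1 := A (ys ! (i - length xs - 1))])" for xs x ys
    by (cases "i < length xs"; cases "i = length xs"; cases "i - length xs")
      (auto simp: list_update_append nth_append)
  show ?thesis unfolding multilinear_def eq using f A unfolding multilinear_def by auto
qed

fun coord :: "'b set \<Rightarrow> 'b list \<Rightarrow> 'b list \<Rightarrow> 'k" where
  "coord E [] [] = 1"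
| "coord E (e # es) (x # xs) = representation E x e * coord E es xs"
| "coord E _ _ = 0"

lemma multilinear_coord:
  assumes "independent E" "span E = UNIV"
  shows "multilinear scale (coord E es)"
proof -
  have 1: "representation E (x + y) e = representation E x e + representation E y e" for x y e
    using representation_add[OF assms(1), of y x] assms(2) by (simp add: add.commute)
  have 2: "representation E (scale c x) e = c * representation E x e" for c x e
    using representation_scale[OF assms(1), of x c] assms(2) by simp
  have "coord E es (xs @ (x + y) # ys) = coord E es (xs @ x # ys) + coord E es (xs @ y # ys)" for xs ys x y
  proof (induction es arbitrary: xs)
    case Nil then show ?case by (cases xs) auto
  next
    case (Cons e es) then show ?case by (cases xs) (auto simp: algebra_simps 1)
  qed
  moreover have "coord E es (xs @ scale c x # ys) = c * coord E es (xs @ x # ys)" for xs ys c x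
  proof (induction es arbitrary: xs)
    case Nil then show ?case by (cases xs) auto
  next
    case (Cons e es) then show ?case by (cases xs) (auto simp: algebra_simps 2)
  qed
  ultimately show ?thesis unfolding multilinear_def by blast
qed


lemma coord_self:
  "independent E \<Longrightarrow> set es' \<subseteq> E \<Longrightarrow> coord E es es' = (if es = es' then 1 else 0)"
  by (induction E es es' rule: coord.induct) (auto simp: representation_basis)

lemma lookup_coaction:
  "Poly_Mapping.lookup (\<delta>\<^sub>L (x + y)) g = Poly_Mapping.lookup (\<delta>\<^sub>L x) g + Poly_Mapping.lookup (\<delta>\<^sub>L y) g"
  "Poly_Mapping.lookup (\<delta>\<^sub>L (scale c x)) g = scale c (Poly_Mapping.lookup (\<delta>\<^sub>L x) g)"
  "Poly_Mapping.lookup (\<delta>\<^sub>R (x + y)) g = Poly_Mapping.lookup (\<delta>\<^sub>R x) g + Poly_Mapping.lookup (\<delta>\<^sub>R y) g"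
  "Poly_Mapping.lookup (\<delta>\<^sub>R (scale c x)) g = scale c (Poly_Mapping.lookup (\<delta>\<^sub>R x) g)"
  "\<delta>\<^sub>L 0 = 0" "\<delta>\<^sub>R 0 = 0"
proof -
  interpret L: Vector_Spaces.linear scale "pm_scale scale" \<delta>\<^sub>L by (rule linear_left_coaction)
  interpret R: Vector_Spaces.linear scale "pm_scale scale" \<delta>\<^sub>R by (rule linear_right_coaction)
  show "Poly_Mapping.lookup (\<delta>\<^sub>L (x + y)) g = Poly_Mapping.lookup (\<delta>\<^sub>L x) g + Poly_Mapping.lookup (\<delta>\<^sub>L y) g"
    "Poly_Mapping.lookup (\<delta>\<^sub>L (scale c x)) g = scale c (Poly_Mapping.lookup (\<delta>\<^sub>L x) g)"
    "Poly_Mapping.lookup (\<delta>\<^sub>R (x + y)) g = Poly_Mapping.lookup (\<delta>\<^sub>R x) g + Poly_Mapping.lookup (\<delta>\<^sub>R y) g"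
    "Poly_Mapping.lookup (\<delta>\<^sub>R (scale c x)) g = scale c (Poly_Mapping.lookup (\<delta>\<^sub>R x) g)"
    "\<delta>\<^sub>L 0 = 0" "\<delta>\<^sub>R 0 = 0"
    by (simp_all add: L.add L.scale L.zero R.add R.scale R.zero lookup_add lookup_pm_scale)
qed

definition compL :: "'g \<Rightarrow> 'b \<Rightarrow> 'b" where "compL g b = Poly_Mapping.lookup (\<delta>\<^sub>L b) g"
definition compR :: "'g \<Rightarrow> 'b \<Rightarrow> 'b" where "compR g b = Poly_Mapping.lookup (\<delta>\<^sub>R b) g"

lemma compL_compL: "compL h (compL g b) = (if g = h then compL g b else 0)"
  using arg_cong[OF left_coassoc[of b], of "\<lambda>z. Poly_Mapping.lookup z (g, h)"]
  by (auto simp add: compL_def lookup_pair_sum lookup_diag_sum lookup_coaction split: if_splits)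

lemma compR_compR: "compR h (compR g b) = (if g = h then compR g b else 0)"
  using arg_cong[OF right_coassoc[of b], of "\<lambda>z. Poly_Mapping.lookup z (h, g)"]
  by (auto simp add: compR_def lookup_pair_sum' lookup_diag_sum lookup_coaction split: if_splits)

lemma compR_compL: "compR h (compL g b) = compL g (compR h b)"
  using arg_cong[OF bicomodule[of b], of "\<lambda>z. Poly_Mapping.lookup z (g, h)"]
  by (simp add: compL_def compR_def lookup_pair_sum lookup_pair_sum' lookup_coaction)

lemma isotypic_iff:
  "b \<in> isotypic \<delta>\<^sub>L \<delta>\<^sub>R y x \<longleftrightarrow>
   (\<forall>g. compL g b = (if g = y then b else 0)) \<and> (\<forall>g. compR g b = (if g = x then b else 0))"
  by (auto simp: isotypic_def poly_mapping_eq_iff compL_def compR_def lookup_single when_def fun_eq_iff)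

lemma comp_zero: "compL g 0 = 0" "compR g 0 = 0"
  by (simp_all add: compL_def compR_def lookup_coaction)

lemma comp_isotypic: "compR x (compL y b) \<in> isotypic \<delta>\<^sub>L \<delta>\<^sub>R y x"
  unfolding isotypic_iff
  by (auto simp: compR_compR compR_compL[symmetric] compL_compL comp_zero)

lemma comp_decomp:
  "b = (\<Sum>y\<in>Poly_Mapping.keys (\<delta>\<^sub>L b). \<Sum>x\<in>Poly_Mapping.keys (\<delta>\<^sub>R (compL y b)). compR x (compL y b))"
  using left_counit[of b] right_counit by (simp add: pm_lin_pure compL_def compR_def)

context
  fixes E assumes bases: "isotypic_bases scale \<delta>\<^sub>L \<delta>\<^sub>R E"
begin

lemma bases_span: "span (\<Union>y x. E y x) = UNIV"
proof -
  have "b \<in> span (\<Union>y x. E y x)" for b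
  proof -
    have "compR x (compL y b) \<in> span (\<Union>y x. E y x)" for x y
      using comp_isotypic[of x y b] bases span_mono[of "E y x" "\<Union>y x. E y x"]
      unfolding isotypic_bases_def by blast
    then show ?thesis by (subst comp_decomp) (intro span_sum)
  qed
  then show ?thesis by auto
qed

lemma base_isotypic: "e \<in> E y x \<Longrightarrow> e \<in> isotypic \<delta>\<^sub>L \<delta>\<^sub>R y x"
  using bases span_base unfolding isotypic_bases_def by blast

lemma base_nonzero: "e \<in> E y x \<Longrightarrow> e \<noteq> 0"
  using bases dependent_zero unfolding isotypic_bases_def by blast

lemma base_unique:
  assumes "e \<in> E y x" "e \<in> E y' x'" shows "y = y'" "x = x'"
  using base_isotypic[OF assms(1)] base_isotypic[OF assms(2)] base_nonzero[OF assms(1)]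
  unfolding isotypic_iff by metis+

lemma quiver_simps:
  "verts (quiver E) = UNIV" "arcs (quiver E) = (\<Union>y x. E y x)"
  "e \<in> E y x \<Longrightarrow> tail (quiver E) e = x" "e \<in> E y x \<Longrightarrow> head (quiver E) e = y"
  by (auto simp: quiver_def intro!: the_equality dest: base_unique)

lemma comp_sum:
  "compL g (\<Sum>i\<in>S. scale (c i) (v i)) = (\<Sum>i\<in>S. scale (c i) (compL g (v i)))"
  "compR g (\<Sum>i\<in>S. scale (c i) (v i)) = (\<Sum>i\<in>S. scale (c i) (compR g (v i)))"
  by (induction S rule: infinite_finite_induct; simp add: compL_def compR_def lookup_coaction)+

lemma bases_independent: "independent (\<Union>y x. E y x)"
  unfolding independent_explicit_module
proof (intro allI impI)
  fix S u e
  assume S: "finite S" "S \<subseteq> (\<Union>y x. E y x)" and 0: "(\<Sum>v\<in>S. scale (u v) v) = 0"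
    and eS: "e \<in> S"
  obtain y x where e: "e \<in> S" "e \<in> E y x" using S(2) eS by blast
  have c: "compR x (compL y v) = (if v \<in> E y x then v else 0)" if "v \<in> S" for v
  proof -
    obtain y' x' where v: "v \<in> E y' x'" using S(2) \<open>v \<in> S\<close> by blast
    have "v \<in> E y x \<longleftrightarrow> y = y' \<and> x = x'" using v base_unique by blast
    then show ?thesis using base_isotypic[OF v] unfolding isotypic_iff by (auto simp: comp_zero)
  qed
  have "0 = compR x (compL y (\<Sum>v\<in>S. scale (u v) v))" by (simp add: 0 comp_zero)
  also have "\<dots> = (\<Sum>v\<in>S. scale (u v) (compR x (compL y v)))" by (simp add: comp_sum)
  also have "\<dots> = (\<Sum>v\<in>S. if v \<in> E y x then scale (u v) v else 0)" using c by (intro sum.cong) auto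
  also have "\<dots> = (\<Sum>v\<in>S \<inter> E y x. scale (u v) v)" using S(1) by (simp add: sum.inter_restrict)
  finally have "(\<Sum>v\<in>S \<inter> E y x. scale (u v) v) = 0" ..
  moreover have "independent (E y x)" using bases unfolding isotypic_bases_def by blast
  ultimately show "u e = 0"
    using independentD[of "E y x" "S \<inter> E y x" u e] S(1) e by blast
qed


definition composable :: "'b list \<Rightarrow> bool" where
  "composable es \<longleftrightarrow> set es \<subseteq> (\<Union>y x. E y x) \<and>
     (\<forall>i. Suc i < length es \<longrightarrow> head (quiver E) (es ! i) = tail (quiver E) (es ! Suc i))"

lemma cas_iff:
  "es \<noteq> [] \<Longrightarrow> (\<exists>v. pre_digraph.cas (quiver E) u es v) \<longleftrightarrow>
     tail (quiver E) (hd es) = u \<and>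
     (\<forall>i. Suc i < length es \<longrightarrow> head (quiver E) (es ! i) = tail (quiver E) (es ! Suc i))"
proof (induction es arbitrary: u)
  case (Cons e es)
  show ?case
  proof (cases "es = []")
    case True
    then show ?thesis by (simp add: pre_digraph.cas.simps)
  next
    case False
    have "(\<forall>i. Suc i < length (e # es) \<longrightarrow> head (quiver E) ((e # es) ! i) = tail (quiver E) ((e # es) ! Suc i))
      \<longleftrightarrow> head (quiver E) e = tail (quiver E) (hd es) \<and>
        (\<forall>i. Suc i < length es \<longrightarrow> head (quiver E) (es ! i) = tail (quiver E) (es ! Suc i))"
      using False by (auto simp: hd_conv_nth nth_Cons split: nat.splits)
    then show ?thesis using Cons.IH[OF False, of "head (quiver E) e"] by (auto simp: pre_digraph.cas.simps)
  qed
qed simp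

lemma paths_iff:
  "0 < p \<Longrightarrow> (u, es) \<in> paths_of_length (quiver E) p \<longleftrightarrow>
     composable es \<and> length es = p \<and> u = tail (quiver E) (hd es)"
  using cas_iff[of es u]
  by (auto simp: paths_of_length_def paths_def pre_digraph.awalk_def quiver_simps composable_def)

lemma path_tensor_apply:
  "multilinear scale f \<Longrightarrow>
     path_tensor scale x f = (\<Sum>\<alpha>\<in>Poly_Mapping.keys x. Poly_Mapping.lookup x \<alpha> * f (snd \<alpha>))"
  by (simp add: path_tensor_def pm_lin_def pure_tensor_def case_prod_unfold)

lemma path_tensor_coord:
  assumes "0 < p" "x \<in> free_on (paths_of_length (quiver E) p)" "(u, es) \<in> paths_of_length (quiver E) p"
  shows "path_tensor scale x (coord (\<Union>y x. E y x) es) = Poly_Mapping.lookup x (u, es)"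
proof -
  let ?B = "\<Union>y x. E y x"
  have "path_tensor scale x (coord ?B es) =
    (\<Sum>\<alpha>\<in>Poly_Mapping.keys x. Poly_Mapping.lookup x \<alpha> * coord ?B es (snd \<alpha>))"
    by (rule path_tensor_apply[OF multilinear_coord[OF bases_independent bases_span]])
  also have "\<dots> = (\<Sum>\<alpha>\<in>Poly_Mapping.keys x. if \<alpha> = (u, es) then Poly_Mapping.lookup x \<alpha> else 0)"
  proof (rule sum.cong[OF refl])
    fix \<alpha> assume "\<alpha> \<in> Poly_Mapping.keys x"
    then have a: "(fst \<alpha>, snd \<alpha>) \<in> paths_of_length (quiver E) p" using assms(2) by (auto simp: free_on_def)
    then have "set (snd \<alpha>) \<subseteq> ?B" using assms(1) unfolding paths_iff[OF assms(1)] composable_def by blast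
    then show "Poly_Mapping.lookup x \<alpha> * coord ?B es (snd \<alpha>) =
        (if \<alpha> = (u, es) then Poly_Mapping.lookup x \<alpha> else 0)"
      using a assms(3) paths_iff[OF assms(1)] by (cases \<alpha>) (auto simp: coord_self[OF bases_independent])
  qed
  also have "\<dots> = Poly_Mapping.lookup x (u, es)" by (rule sum_delta_keys) simp
  finally show ?thesis .
qed

lemma multilinear_zero: "multilinear scale f \<Longrightarrow> f (xs @ 0 # ys) = 0"
  using multilinear_sum[of f "{}" xs] by simp

lemma multilinear_update_zero: "multilinear scale f \<Longrightarrow> i < length xs \<Longrightarrow> f (xs[i := 0]) = 0"
  by (simp add: upd_conv_take_nth_drop multilinear_zero)

lemma multilinear_compL: "multilinear scale f \<Longrightarrow> multilinear scale (\<lambda>xs. f (xs[i := compL g (xs ! i)]))"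
  by (erule multilinear_update) (simp_all add: compL_def lookup_coaction)

lemma multilinear_compR: "multilinear scale f \<Longrightarrow> multilinear scale (\<lambda>xs. f (xs[i := compR g (xs ! i)]))"
  by (erule multilinear_update) (simp_all add: compR_def lookup_coaction)

lemma cotensor_power_iff:
  "t \<in> cotensor_power scale \<delta>\<^sub>L \<delta>\<^sub>R p \<longleftrightarrow> t \<in> tensor_power scale p \<and>
     (\<forall>i g f. Suc i < p \<longrightarrow> multilinear scale f \<longrightarrow>
        t (\<lambda>xs. f (xs[Suc i := compR g (xs ! Suc i)])) = t (\<lambda>xs. f (xs[i := compL g (xs ! i)])))"
  by (simp add: cotensor_power_def compL_def compR_def)

lemma path_tensor_in:
  assumes "0 < p" "x \<in> free_on (paths_of_length (quiver E) p)"
  shows "path_tensor scale x \<in> cotensor_power scale \<delta>\<^sub>L \<delta>\<^sub>R p"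
  unfolding cotensor_power_iff
proof (intro conjI allI impI)
  let ?w = "\<Sum>\<alpha>\<in>Poly_Mapping.keys x. single (snd \<alpha>) (Poly_Mapping.lookup x \<alpha>)"
  have "path_tensor scale x = tensor_sum scale ?w"
    unfolding path_tensor_def tensor_sum_def
    by (subst pm_lin_sum_single) (auto simp: pm_lin_def algebra_simps case_prod_unfold)
  moreover have "?w \<in> free_on {xs. length xs = p}"
  proof -
    have "Poly_Mapping.keys ?w \<subseteq> (\<Union>\<alpha>\<in>Poly_Mapping.keys x. {snd \<alpha>})"
      by (rule order_trans[OF keys_sum]) auto
    then show ?thesis using assms(2) by (auto simp: free_on_def paths_of_length_def)
  qed
  ultimately show "path_tensor scale x \<in> tensor_power scale p" by (auto simp: tensor_power_def)
next
  fix i g f assume i: "Suc i < p" and f: "multilinear scale f"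
  have "f ((snd \<alpha>)[Suc i := compR g (snd \<alpha> ! Suc i)]) = f ((snd \<alpha>)[i := compL g (snd \<alpha> ! i)])"
    if "\<alpha> \<in> Poly_Mapping.keys x" for \<alpha>
  proof -
    define es where "es = snd \<alpha>"
    have a: "(fst \<alpha>, es) \<in> paths_of_length (quiver E) p" using assms(2) that by (auto simp: free_on_def es_def)
    then have c: "set es \<subseteq> (\<Union>y x. E y x)" "length es = p"
      "head (quiver E) (es ! i) = tail (quiver E) (es ! Suc i)"
      using assms(1) i by (auto simp: paths_iff composable_def)
    have "es ! i \<in> set es" "es ! Suc i \<in> set es" using c(2) i by auto
    then obtain y x z w where e: "es ! i \<in> E y x" "es ! Suc i \<in> E z w" using c(1) by blast
    then have "w = y" using c(3) by (simp add: quiver_simps)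
    then have "compR g (es ! Suc i) = (if g = y then es ! Suc i else 0)"
      "compL g (es ! i) = (if g = y then es ! i else 0)"
      using base_isotypic[OF e(1)] base_isotypic[OF e(2)] by (auto simp: isotypic_iff)
    then show ?thesis using f c(2) i by (simp add: multilinear_update_zero flip: es_def)
  qed
  then show "path_tensor scale x (\<lambda>xs. f (xs[Suc i := compR g (xs ! Suc i)])) =
      path_tensor scale x (\<lambda>xs. f (xs[i := compL g (xs ! i)]))"
    by (simp add: path_tensor_apply multilinear_compL[OF f] multilinear_compR[OF f])
qed

lemma expand:
  assumes "finite S" "\<And>x. x \<in> set xs \<Longrightarrow> {e. representation (\<Union>y x. E y x) x e \<noteq> 0} \<subseteq> S" "multilinear scale f"
  shows "f xs = (\<Sum>es\<in>{es. set es \<subseteq> S \<and> length es = length xs}. coord (\<Union>y x. E y x) es xs * f es)"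
  using assms(2,3)
proof (induction xs arbitrary: f)
  case Nil
  have "{es. set es \<subseteq> S \<and> length es = length []} = {[]}" by auto
  then show ?case by simp
next
  case (Cons x xs)
  let ?B = "\<Union>y x. E y x"
  let ?L = "{es. set es \<subseteq> S \<and> length es = length xs}"
  have "x = (\<Sum>e | representation ?B x e \<noteq> 0. scale (representation ?B x e) e)"
    using sum_nonzero_representation_eq[OF bases_independent, of x] bases_span by simp
  also have "\<dots> = (\<Sum>e\<in>S. scale (representation ?B x e) e)"
    using Cons.prems(1)[of x] assms(1) by (intro sum.mono_neutral_left) auto
  finally have x: "x = (\<Sum>e\<in>S. scale (representation ?B x e) e)" .
  have "f (x # xs) = (\<Sum>e\<in>S. representation ?B x e * f (e # xs))"
    using multilinear_sum[OF Cons.prems(2) assms(1), of "[]" "representation ?B x" "\<lambda>e. e" xs] x by simp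
  also have "\<dots> = (\<Sum>e\<in>S. \<Sum>es\<in>?L. representation ?B x e * (coord ?B es xs * f (e # es)))"
  proof (intro sum.cong refl)
    fix e
    have "f (e # xs) = (\<Sum>es\<in>?L. coord ?B es xs * f (e # es))"
      by (rule Cons.IH[OF _ multilinear_Cons[OF Cons.prems(2)]]) (use Cons.prems(1) in auto)
    then show "representation ?B x e * f (e # xs) = (\<Sum>es\<in>?L. representation ?B x e * (coord ?B es xs * f (e # es)))"
      by (simp add: sum_distrib_left)
  qed
  also have "\<dots> = (\<Sum>(e, es)\<in>S \<times> ?L. coord ?B (e # es) (x # xs) * f (e # es))"
    by (simp add: sum.cartesian_product mult.assoc)
  also have "\<dots> = (\<Sum>es\<in>(\<lambda>(e, es). e # es) ` (S \<times> ?L). coord ?B es (x # xs) * f es)"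
    by (subst sum.reindex) (auto simp: inj_on_def case_prod_unfold)
  also have "(\<lambda>(e, es). e # es) ` (S \<times> ?L) = {es. set es \<subseteq> S \<and> length es = length (x # xs)}"
    by (auto simp: length_Suc_conv image_iff)
  finally show ?case .
qed

lemma rep_comp:
  assumes "e \<in> E y x"
  shows "representation (\<Union>y x. E y x) (compL y b) e = representation (\<Union>y x. E y x) b e"
    and "representation (\<Union>y x. E y x) (compR g b) e = (if g = x then representation (\<Union>y x. E y x) b e else 0)"
proof -
  let ?B = "\<Union>y x. E y x"
  let ?S = "{e. representation ?B b e \<noteq> 0}"
  have fin: "finite ?S" by (rule finite_representation)
  have b: "b = (\<Sum>e'\<in>?S. scale (representation ?B b e') e')"
    using sum_nonzero_representation_eq[OF bases_independent, of b] bases_span by simp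
  have rep: "representation ?B (\<Sum>i\<in>?S. scale (c i) (v i)) e = (\<Sum>i\<in>?S. c i * representation ?B (v i) e)" for c v
    using representation_sum[OF bases_independent, of ?S "\<lambda>i. scale (c i) (v i)"] bases_span
    by (simp add: representation_scale[OF bases_independent])
  have B: "e' \<in> ?B" if "e' \<in> ?S" for e' using that representation_ne_zero[of ?B b e'] by blast
  have re: "representation ?B e' e = (if e' = e then 1 else 0)" if "e' \<in> ?B" for e'
    using representation_basis[OF bases_independent that] by auto
  have cl: "compL y b = (\<Sum>e'\<in>?S. scale (representation ?B b e') (compL y e'))"
    using arg_cong[OF b, of "compL y"] unfolding comp_sum .
  have cr: "compR g b = (\<Sum>e'\<in>?S. scale (representation ?B b e') (compR g e'))"
    using arg_cong[OF b, of "compR g"] unfolding comp_sum .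
  have "representation ?B (compL y b) e = (\<Sum>e'\<in>?S. representation ?B b e' * representation ?B (compL y e') e)"
    unfolding cl by (rule rep)
  also have "\<dots> = (\<Sum>e'\<in>?S. if e' = e then representation ?B b e' else 0)"
  proof (rule sum.cong[OF refl])
    fix e' assume "e' \<in> ?S"
    then obtain y' x' where e': "e' \<in> E y' x'" using B by blast
    then have r: "representation ?B e' e = (if e' = e then 1 else 0)" by (intro re) blast
    have "compL y e' = (if y = y' then e' else 0)" using base_isotypic[OF e'] by (auto simp: isotypic_iff)
    then show "representation ?B b e' * representation ?B (compL y e') e = (if e' = e then representation ?B b e' else 0)"
      using r e' base_unique(1)[OF assms, of y' x'] by (auto simp: representation_zero)
  qed
  also have "\<dots> = representation ?B b e" using fin by (auto simp: sum.delta)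
  finally show "representation ?B (compL y b) e = representation ?B b e" .
  have "representation ?B (compR g b) e = (\<Sum>e'\<in>?S. representation ?B b e' * representation ?B (compR g e') e)"
    unfolding cr by (rule rep)
  also have "\<dots> = (\<Sum>e'\<in>?S. if e' = e then (if g = x then representation ?B b e' else 0) else 0)"
  proof (rule sum.cong[OF refl])
    fix e' assume "e' \<in> ?S"
    then obtain y' x' where e': "e' \<in> E y' x'" using B by blast
    then have r: "representation ?B e' e = (if e' = e then 1 else 0)" by (intro re) blast
    have "compR g e' = (if g = x' then e' else 0)" using base_isotypic[OF e'] by (auto simp: isotypic_iff)
    then show "representation ?B b e' * representation ?B (compR g e') e =
        (if e' = e then (if g = x then representation ?B b e' else 0) else 0)"
      using r e' base_unique(2)[OF assms, of y' x'] by (auto simp: representation_zero)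
  qed
  also have "\<dots> = (if g = x then representation ?B b e else 0)" using fin by (auto simp: sum.delta)
  finally show "representation ?B (compR g b) e = (if g = x then representation ?B b e else 0)" .
qed

lemma coord_update:
  "i < length es \<Longrightarrow> length xs = length es \<Longrightarrow>
     (representation B z (es ! i) = representation B (xs ! i) (es ! i) \<longrightarrow> coord B es (xs[i := z]) = coord B es xs) \<and>
     (representation B z (es ! i) = 0 \<longrightarrow> coord B es (xs[i := z]) = 0)"
  by (induction B es xs arbitrary: i rule: coord.induct) (auto simp: less_Suc_eq_0_disj)

lemma cotensor_coord:
  assumes t: "t \<in> cotensor_power scale \<delta>\<^sub>L \<delta>\<^sub>R p" and es: "set es \<subseteq> (\<Union>y x. E y x)" "length es = p"
    and nz: "t (coord (\<Union>y x. E y x) es) \<noteq> 0"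
  shows "composable es"
  unfolding composable_def
proof (intro conjI allI impI es(1))
  fix i assume i: "Suc i < length es"
  let ?B = "\<Union>y x. E y x"
  note mc = multilinear_coord[OF bases_independent bases_span, of es]
  have "es ! i \<in> set es" "es ! Suc i \<in> set es" using i by auto
  then obtain y x z w where e: "es ! i \<in> E y x" "es ! Suc i \<in> E z w" using es(1) by blast
  show "head (quiver E) (es ! i) = tail (quiver E) (es ! Suc i)"
  proof (rule ccontr)
    assume "\<not> ?thesis"
    then have yw: "y \<noteq> w" using e by (simp add: quiver_simps)
    obtain u where u: "t = tensor_sum scale u" "u \<in> free_on {xs. length xs = p}"
      using t by (auto simp: cotensor_power_iff tensor_power_def)
    have t_apply: "t f = (\<Sum>xs\<in>Poly_Mapping.keys u. Poly_Mapping.lookup u xs * f xs)" if "multilinear scale f" for f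
      using that by (simp add: u tensor_sum_def pm_lin_def pure_tensor_def)
    have len: "length xs = length es" if "xs \<in> Poly_Mapping.keys u" for xs
      using that u(2) es(2) by (auto simp: free_on_def)
    have L: "t (\<lambda>xs. coord ?B es (xs[i := compL y (xs ! i)])) = t (coord ?B es)"
      unfolding t_apply[OF multilinear_compL[OF mc]] t_apply[OF mc]
      using i len coord_update rep_comp(1)[OF e(1)] by (intro sum.cong) auto
    have R: "t (\<lambda>xs. coord ?B es (xs[Suc i := compR y (xs ! Suc i)])) = 0"
      unfolding t_apply[OF multilinear_compR[OF mc]]
      using i len coord_update rep_comp(2)[OF e(2)] yw by (intro sum.neutral) auto
    have "t (\<lambda>xs. coord ?B es (xs[Suc i := compR y (xs ! Suc i)])) = t (\<lambda>xs. coord ?B es (xs[i := compL y (xs ! i)]))"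
      using t i es(2) mc unfolding cotensor_power_iff by blast
    then show False using L R nz by simp
  qed
qed

lemma path_tensor_surj:
  assumes p: "0 < p" and t: "t \<in> cotensor_power scale \<delta>\<^sub>L \<delta>\<^sub>R p"
  shows "\<exists>x\<in>free_on (paths_of_length (quiver E) p). t = path_tensor scale x"
proof -
  let ?B = "\<Union>y x. E y x"
  obtain u where u: "t = tensor_sum scale u" "u \<in> free_on {xs. length xs = p}"
    using t by (auto simp: cotensor_power_iff tensor_power_def)
  have t_apply: "t f = (\<Sum>xs\<in>Poly_Mapping.keys u. Poly_Mapping.lookup u xs * f xs)" if "multilinear scale f" for f
    using that by (simp add: u tensor_sum_def pm_lin_def pure_tensor_def)
  define S where "S = (\<Union>xs\<in>Poly_Mapping.keys u. \<Union>x\<in>set xs. {e. representation ?B x e \<noteq> 0})"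
  have S: "finite S" "S \<subseteq> ?B"
    unfolding S_def by (auto simp: finite_representation dest!: representation_ne_zero)
  define L where "L = {es. set es \<subseteq> S \<and> length es = p}"
  have finL: "finite L" unfolding L_def by (rule finite_lists_length_eq[OF S(1)])
  define x where "x = (\<Sum>es\<in>{es\<in>L. composable es}. single (tail (quiver E) (hd es), es) (t (coord ?B es)))"
  have "Poly_Mapping.keys x \<subseteq> (\<Union>es\<in>{es\<in>L. composable es}. {(tail (quiver E) (hd es), es)})"
    unfolding x_def by (rule order_trans[OF keys_sum]) auto
  then have xP: "x \<in> free_on (paths_of_length (quiver E) p)"
    using p by (auto simp: free_on_def paths_iff L_def)
  have "t f = path_tensor scale x f" for f
  proof (cases "multilinear scale f")
    case False
    then show ?thesis by (simp add: path_tensor_def u(1) tensor_sum_def pure_tensor_def pm_lin_def case_prod_unfold)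
  next
    case True
    have "path_tensor scale x f = (\<Sum>es\<in>{es\<in>L. composable es}. t (coord ?B es) * f es)"
      unfolding path_tensor_def x_def
      by (subst pm_lin_sum_single) (auto simp: pure_tensor_def True algebra_simps)
    also have "\<dots> = (\<Sum>es\<in>L. t (coord ?B es) * f es)"
      using finL S(2) cotensor_coord[OF t] by (intro sum.mono_neutral_left) (auto simp: L_def)
    also have "\<dots> = (\<Sum>es\<in>L. \<Sum>xs\<in>Poly_Mapping.keys u. Poly_Mapping.lookup u xs * (coord ?B es xs * f es))"
      by (simp add: t_apply[OF multilinear_coord[OF bases_independent bases_span]] sum_distrib_right mult.assoc)
    also have "\<dots> = (\<Sum>xs\<in>Poly_Mapping.keys u. Poly_Mapping.lookup u xs * (\<Sum>es\<in>L. coord ?B es xs * f es))"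
      by (subst sum.swap) (simp add: sum_distrib_left)
    also have "\<dots> = (\<Sum>xs\<in>Poly_Mapping.keys u. Poly_Mapping.lookup u xs * f xs)"
    proof (intro sum.cong refl)
      fix xs assume xs: "xs \<in> Poly_Mapping.keys u"
      then have len: "length xs = p" using u(2) by (auto simp: free_on_def)
      have "f xs = (\<Sum>es\<in>{es. set es \<subseteq> S \<and> length es = length xs}. coord ?B es xs * f es)"
        by (rule expand[OF S(1) _ True]) (use xs in \<open>auto simp: S_def\<close>)
      then show "Poly_Mapping.lookup u xs * (\<Sum>es\<in>L. coord ?B es xs * f es) = Poly_Mapping.lookup u xs * f xs"
        by (simp add: len L_def)
    qed
    also have "\<dots> = t f" by (simp add: t_apply[OF True])
    finally show ?thesis ..
  qed
  then show ?thesis using xP by blast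
qed

text \<open>
  For \<open>p \<ge> 1\<close> the \<open>p\<close>-th cotensor power of the bicomodule \<open>B\<close> is identified with \<open>kQ\<^sub>p\<close>, the path
  \<open>a\<^sub>p \<cdots> a\<^sub>1\<close> corresponding to \<open>a\<^sub>p \<otimes> \<cdots> \<otimes> a\<^sub>1\<close>.  The product below is stated on \<open>kQ\<close>.
\<close>

theorem bij_betw_path_tensor:
  assumes "0 < p"
  shows "bij_betw (path_tensor scale) (free_on (paths_of_length (quiver E) p)) (cotensor_power scale \<delta>\<^sub>L \<delta>\<^sub>R p)"
  unfolding bij_betw_def
proof
  show "inj_on (path_tensor scale) (free_on (paths_of_length (quiver E) p))"
  proof (rule inj_onI, rule poly_mapping_eqI)
    fix x x' :: "('g, 'b) path \<Rightarrow>\<^sub>0 'k" and \<alpha>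
    assume x: "x \<in> free_on (paths_of_length (quiver E) p)" "x' \<in> free_on (paths_of_length (quiver E) p)"
      and eq: "path_tensor scale x = path_tensor scale x'"
    show "Poly_Mapping.lookup x \<alpha> = Poly_Mapping.lookup x' \<alpha>"
    proof (cases "\<alpha> \<in> paths_of_length (quiver E) p")
      case True
      then show ?thesis
        using path_tensor_coord[OF assms x(1)] path_tensor_coord[OF assms x(2)] eq by (cases \<alpha>) metis
    next
      case False
      then show ?thesis using x unfolding free_on_def mem_Collect_eq by (metis in_keys_iff subsetD)
    qed
  qed
  show "path_tensor scale ` free_on (paths_of_length (quiver E) p) = cotensor_power scale \<delta>\<^sub>L \<delta>\<^sub>R p"
    using path_tensor_in[OF assms] path_tensor_surj[OF assms] by blast
qed

end
end


subsection \<open>The multiplication\<close>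

text \<open>
  The projections of \<open>kQ\<close> onto \<open>kQ\<^sub>0 = kG\<close> and \<open>kQ\<^sub>1 = B\<close>, and the inclusion
  of \<open>B\<close> into \<open>kQ\<close>; the latter takes coordinates in the union of the chosen bases, which is
  a basis of \<open>B\<close> by \<open>bases_independent\<close> and \<open>bases_span\<close>.
\<close>

definition vertex_part :: "(('g, 'b) path \<Rightarrow>\<^sub>0 'k::field) \<Rightarrow> ('g \<Rightarrow>\<^sub>0 'k)" where
  "vertex_part = pm_lin (\<lambda>(u, p) r. if p = [] then single u r else 0)"

definition arrow_part :: "('k::field \<Rightarrow> 'b \<Rightarrow> 'b) \<Rightarrow> (('g, 'b::ab_group_add) path \<Rightarrow>\<^sub>0 'k) \<Rightarrow> 'b" where
  "arrow_part scale = pm_lin (\<lambda>(u, p) r. case p of [a] \<Rightarrow> scale r a | _ \<Rightarrow> 0)"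

definition of_bimodule ::
  "('k::field \<Rightarrow> 'b \<Rightarrow> 'b) \<Rightarrow> ('g \<Rightarrow> 'g \<Rightarrow> 'b::ab_group_add set) \<Rightarrow> 'b \<Rightarrow> (('g, 'b) path \<Rightarrow>\<^sub>0 'k)" where
  "of_bimodule scale E b =
     (let r = module.representation scale (\<Union>y x. E y x) b
      in \<Sum>a\<in>{a. r a \<noteq> 0}. single (tail (quiver E) a, [a]) (r a))"

text \<open>
  For a nonempty list \<open>[x\<^sub>1, \<dots>, x\<^sub>p]\<close>, the element \<open>[x\<^sub>p] \<cdots> [x\<^sub>1]\<close> of \<open>kQ\<^sub>p\<close>; the value at the
  empty list is irrelevant.
\<close>

fun bracket ::
  "('k::field \<Rightarrow> 'b \<Rightarrow> 'b) \<Rightarrow> ('g \<Rightarrow> 'g \<Rightarrow> 'b::ab_group_add set) \<Rightarrow> 'b list \<Rightarrow> (('g, 'b) path \<Rightarrow>\<^sub>0 'k)" where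
  "bracket scale E [] = 0"
| "bracket scale E [x] = of_bimodule scale E x"
| "bracket scale E (x # y # zs) =
     path_concat (quiver E) (bracket scale E (y # zs)) (of_bimodule scale E x)"

text \<open>
  The last two conditions prescribe the components in \<open>kG\<close> and in \<open>B\<close>; as both sides are bilinear in
  \<open>x\<close> and \<open>y\<close>, they do so on all of \<open>C \<otimes> C\<close>.
\<close>

definition is_cotensor_mult ::
  "('k::field \<Rightarrow> 'b \<Rightarrow> 'b) \<Rightarrow> (('g::group_add \<Rightarrow>\<^sub>0 'k) \<Rightarrow> 'b \<Rightarrow> 'b) \<Rightarrow> ('b \<Rightarrow> ('g \<Rightarrow>\<^sub>0 'k) \<Rightarrow> 'b) \<Rightarrow>
   ('g \<Rightarrow> 'g \<Rightarrow> 'b::ab_group_add set) \<Rightarrow>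
   ((('g, 'b) path \<times> ('g, 'b) path \<Rightarrow>\<^sub>0 'k) \<Rightarrow> (('g, 'b) path \<Rightarrow>\<^sub>0 'k)) \<Rightarrow> bool" where
  "is_cotensor_mult scale lact ract E \<phi> \<longleftrightarrow>
     (let P = paths (quiver E); \<Delta> = path_comult (quiver E); \<epsilon> = path_counit in
       coalgebra_map (P \<times> P) (tensor_comult \<Delta> \<Delta>) (tensor_counit \<epsilon> \<epsilon>) P \<Delta> \<epsilon> \<phi> \<and>
       (\<forall>x\<in>free_on P. \<forall>y\<in>free_on P.
          vertex_part (\<phi> (tensor x y)) = vertex_part x * vertex_part y \<and>
          arrow_part scale (\<phi> (tensor x y)) =
            lact (vertex_part x) (arrow_part scale y) + ract (arrow_part scale x) (vertex_part y)))"

definition cotensor_mult ::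
  "('k::field \<Rightarrow> 'b \<Rightarrow> 'b) \<Rightarrow> (('g::group_add \<Rightarrow>\<^sub>0 'k) \<Rightarrow> 'b \<Rightarrow> 'b) \<Rightarrow> ('b \<Rightarrow> ('g \<Rightarrow>\<^sub>0 'k) \<Rightarrow> 'b) \<Rightarrow>
   ('g \<Rightarrow> 'g \<Rightarrow> 'b::ab_group_add set) \<Rightarrow>
   (('g, 'b) path \<times> ('g, 'b) path \<Rightarrow>\<^sub>0 'k) \<Rightarrow> (('g, 'b) path \<Rightarrow>\<^sub>0 'k)" where
  "cotensor_mult scale lact ract E = (THE \<phi>. is_cotensor_mult scale lact ract E \<phi>)"


section \<open>Thin splits\<close>

text \<open>
  A sequence \<open>(d\<^sub>p, \<dots>, d\<^sub>1)\<close> of zeros and ones is the list \<open>[d\<^sub>1, \<dots>, d\<^sub>p]\<close> of booleans, with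
  \<^const>\<open>True\<close> for one; thus \<open>d ! i\<close> is \<open>d\<^bsub>i+1\<^esub>\<close>.  The same reversal applies to thin splits, whose
  entries are vertices (\<^const>\<open>Inl\<close>) or arrows (\<^const>\<open>Inr\<close>).
\<close>

definition thin_seqs :: "nat \<Rightarrow> nat \<Rightarrow> bool list set" where
  "thin_seqs n p = {d. length d = p \<and> count_list d True = n}"

definition thin_split :: "('v, 'a) pre_digraph \<Rightarrow> bool list \<Rightarrow> ('v, 'a) path \<Rightarrow> ('v + 'a) list" where
  "thin_split Q d \<alpha> =
     map (\<lambda>i. let j = count_list (take i d) True in
              if d ! i then Inr (snd \<alpha> ! j)
              else Inl (if j = 0 then fst \<alpha> else head Q (snd \<alpha> ! (j - 1))))
       [0..<length d]"

text \<open>The two remaining cases do not occur, since the second split is taken along the complement.\<close>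

fun thin_factor ::
  "(('g::group_add \<Rightarrow>\<^sub>0 'k::field) \<Rightarrow> 'b \<Rightarrow> 'b) \<Rightarrow> ('b \<Rightarrow> ('g \<Rightarrow>\<^sub>0 'k) \<Rightarrow> 'b) \<Rightarrow> ('g + 'b) \<Rightarrow> ('g + 'b) \<Rightarrow>
   'b::ab_group_add" where
  "thin_factor lact ract (Inr a) (Inl g) = ract a (single g 1)"
| "thin_factor lact ract (Inl g) (Inr a) = lact (single g 1) a"
| "thin_factor lact ract (Inl _) (Inl _) = 0"
| "thin_factor lact ract (Inr _) (Inr _) = 0"

definition thin_product ::
  "('k::field \<Rightarrow> 'b \<Rightarrow> 'b) \<Rightarrow> (('g::group_add \<Rightarrow>\<^sub>0 'k) \<Rightarrow> 'b \<Rightarrow> 'b) \<Rightarrow> ('b \<Rightarrow> ('g \<Rightarrow>\<^sub>0 'k) \<Rightarrow> 'b) \<Rightarrow>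
   ('g \<Rightarrow> 'g \<Rightarrow> 'b::ab_group_add set) \<Rightarrow> ('g, 'b) path \<Rightarrow> ('g, 'b) path \<Rightarrow> bool list \<Rightarrow>
   (('g, 'b) path \<Rightarrow>\<^sub>0 'k)" where
  "thin_product scale lact ract E \<alpha> \<beta> d =
     (if d = [] then single (fst \<alpha> + fst \<beta>, []) 1
      else bracket scale E
        (map2 (thin_factor lact ract)
          (thin_split (quiver E) d \<alpha>) (thin_split (quiver E) (map Not d) \<beta>)))"

end

theory Submission
  imports Defs
begin

text \<open>
  The coefficient of a concatenation \<open>\<gamma>'\<gamma>\<close> in an element \<open>x\<close> of \<open>kQ\<close> is the coefficient of
  \<open>\<gamma>' \<otimes> \<gamma>\<close> in \<open>\<Delta> x\<close>.  Splitting off one arrow at a time, a coalgebra map into \<open>kQ\<close> is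
  therefore determined by its components in \<open>kG\<close> and \<open>B\<close>, so at most one multiplication exists.
  Conversely, cutting a thin split of \<open>(\<alpha>, \<beta>)\<close> at position \<open>l\<close> amounts to cutting \<open>\<alpha>\<close> and \<open>\<beta>\<close> into
  two pieces each, of total length \<open>l\<close> on the right, with a thin split of each pair of pieces;
  hence the sum over thin splits is a coalgebra map.  Its components in \<open>kG\<close> and \<open>B\<close> are the
  prescribed ones, so it is the multiplication.
\<close>

section \<open>Linear maps on free vector spaces\<close>

lemma poly_mapping_sum_singles:
  fixes x :: "'a \<Rightarrow>\<^sub>0 'b::comm_monoid_add"
  shows "x = (\<Sum>a\<in>Poly_Mapping.keys x. single a (Poly_Mapping.lookup x a))"
proof (rule poly_mapping_eqI)
  fix k
  show "Poly_Mapping.lookup x k =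
      Poly_Mapping.lookup (\<Sum>a\<in>Poly_Mapping.keys x. single a (Poly_Mapping.lookup x a)) k"
    using sum_delta_keys[of x k "Poly_Mapping.lookup x"]
    by (simp add: lookup_sum lookup_single when_def)
qed

lemma free_on_add: "x \<in> free_on X \<Longrightarrow> y \<in> free_on X \<Longrightarrow> x + y \<in> free_on X"
  using Poly_Mapping.keys_add[of x y] unfolding free_on_def by blast

lemma free_on_induct [consumes 1, case_names zero single add]:
  fixes x :: "'a \<Rightarrow>\<^sub>0 'b::comm_monoid_add"
  assumes "x \<in> free_on X"
    and "P 0"
    and "\<And>a c. a \<in> X \<Longrightarrow> P (single a c)"
    and "\<And>x y. x \<in> free_on X \<Longrightarrow> y \<in> free_on X \<Longrightarrow> P x \<Longrightarrow> P y \<Longrightarrow> P (x + y)"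
  shows "P x"
proof -
  have "(\<Sum>a\<in>S. single a (Poly_Mapping.lookup x a)) \<in> free_on X \<and>
      P (\<Sum>a\<in>S. single a (Poly_Mapping.lookup x a))"
    if "finite S" "S \<subseteq> X" for S
    using that
  proof (induction S rule: finite_induct)
    case empty
    then show ?case using assms(2) by (simp add: free_on_def)
  next
    case (insert a S)
    let ?x = "single a (Poly_Mapping.lookup x a)" and ?y = "\<Sum>a\<in>S. single a (Poly_Mapping.lookup x a)"
    have "?x \<in> free_on X" using insert.prems by (auto simp: free_on_def)
    moreover have "?y \<in> free_on X" "P ?y" using insert by auto
    moreover have "?x + ?y \<in> free_on X" using calculation(1,2) by (rule free_on_add)
    ultimately show ?case using insert assms(3,4) by simp
  qed
  from this[of "Poly_Mapping.keys x"] show ?thesis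
    using assms(1) poly_mapping_sum_singles[of x] by (simp add: free_on_def)
qed

text \<open>Agreement on every multiple \<open>single a c\<close> replaces homogeneity, so the
  codomain can be any abelian group: a free space, the field or the bimodule. Additivity is asked on
  the whole type.\<close>

lemma additive_ext_on_free:
  fixes x :: "'a \<Rightarrow>\<^sub>0 'b::comm_monoid_add"
  assumes "x \<in> free_on X"
    and "\<And>x y. f (x + y) = f x + f y" "\<And>x y. g (x + y) = g x + g y"
    and "\<And>a c. a \<in> X \<Longrightarrow> f (single a c) = g (single a c)"
  shows "f x = (g x :: 'c::ab_group_add)"
  using assms(1)
proof (induction rule: free_on_induct)
  case zero
  show ?case using assms(2)[of 0 0] assms(3)[of 0 0] by simp
qed (simp_all add: assms)

lemma lookup_scale_mult [simp]:
  "Poly_Mapping.lookup (pm_scale (*) (c::'k::field) x) a = c * Poly_Mapping.lookup x a"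
  by (simp add: lookup_pm_scale)

lemma scale_single [simp]: "pm_scale (*) (c::'k::field) (single a r) = single a (c * r)"
  by (rule poly_mapping_eqI) (simp add: lookup_single when_def)

lemma scale_add:
  "pm_scale (*) (c + c') x = pm_scale (*) c x + pm_scale (*) (c'::'k::field) x"
  "pm_scale (*) c (x + y) = pm_scale (*) c x + pm_scale (*) c y"
  "pm_scale (*) (0::'k) x = 0"
  by (auto intro!: poly_mapping_eqI simp: lookup_add algebra_simps)

section \<open>Tensor products of free spaces and of maps\<close>

lemma lookup_tensor:
  fixes x :: "'a \<Rightarrow>\<^sub>0 'k::field" and y :: "'c \<Rightarrow>\<^sub>0 'k"
  shows "Poly_Mapping.lookup (tensor x y) (a, b) = Poly_Mapping.lookup x a * Poly_Mapping.lookup y b"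
proof -
  have "Poly_Mapping.lookup (pm_lin (\<lambda>b s. single (a', b) (r * s)) y) (a, b) =
     (if a' = a then r * Poly_Mapping.lookup y b else 0)" for a' and r :: 'k
    unfolding lookup_pm_lin lookup_single when_def
    using sum_delta_keys[of y b "\<lambda>b. r * Poly_Mapping.lookup y b"] by (cases "a' = a") auto
  then show ?thesis
    unfolding tensor_def lookup_pm_lin[of _ x]
    using sum_delta_keys[of x a "\<lambda>a'. Poly_Mapping.lookup x a' * Poly_Mapping.lookup y b"] by simp
qed

lemma tensor_add:
  "tensor (x + x') y = tensor x y + tensor x' y"
  "tensor x (y + y') = tensor x y + tensor x y'"
  by (auto intro!: poly_mapping_eqI simp: lookup_tensor lookup_add algebra_simps)

lemma tensor_single [simp]: "tensor (single a r) (single b s) = single (a, b) (r * s)"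
  by (auto intro!: poly_mapping_eqI simp: lookup_tensor lookup_single when_def)

lemma tensor_sum_left: "tensor (\<Sum>i\<in>I. f i) y = (\<Sum>i\<in>I. tensor (f i) y)"
  by (auto intro!: poly_mapping_eqI simp: lookup_tensor lookup_sum sum_distrib_right)

lemma tensor_sum_right: "tensor x (\<Sum>i\<in>I. f i) = (\<Sum>i\<in>I. tensor x (f i))"
  by (auto intro!: poly_mapping_eqI simp: lookup_tensor lookup_sum sum_distrib_left)

lemma tensor_in_free_on:
  assumes "x \<in> free_on X" "y \<in> free_on Y" shows "tensor x y \<in> free_on (X \<times> Y)"
  using assms by (auto simp: free_on_def lookup_tensor in_keys_iff subset_iff)

text \<open>\<open>tensor_map\<close> reads \<open>f\<close> and \<open>f'\<close> on basis elements
  only and extends linearly, so it is additive for arbitrary functions, including maps that are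
  undefined off a subspace.\<close>

lemma tensor_map_add: "tensor_map f f' (x + y) = tensor_map f f' x + tensor_map f f' y"
  unfolding tensor_map_def by (rule pm_lin_add) (auto simp: scale_add)

lemma tensor_map_single:
  "tensor_map f f' (single (a, b) r) = pm_scale (*) r (tensor (f (single a 1)) (f' (single b 1)))"
  unfolding tensor_map_def by (subst pm_lin_single) (auto simp: scale_add)

lemma tensor_map_sum_single:
  "tensor_map f f' (\<Sum>i\<in>I. single (a i, b i) (c i)) =
     (\<Sum>i\<in>I. pm_scale (*) (c i) (tensor (f (single (a i) 1)) (f' (single (b i) 1))))"
  unfolding tensor_map_def by (subst pm_lin_sum_single) (auto simp: scale_add)

lemma middle_swap_add: "middle_swap (x + y) = middle_swap x + middle_swap y"
  unfolding middle_swap_def by (rule pm_lin_add) (auto simp: single_add)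

lemma middle_swap_sum_single:
  "middle_swap (\<Sum>i\<in>I. single ((a i, b i), (c i, d i)) (r i)) = (\<Sum>i\<in>I. single ((a i, c i), (b i, d i)) (r i))"
  unfolding middle_swap_def by (subst pm_lin_sum_single) (auto simp: single_add)

lemma tensor_comult_add:
  "tensor_comult \<Delta> \<Delta>' (x + y) = tensor_comult \<Delta> \<Delta>' x + tensor_comult \<Delta> \<Delta>' y"
  by (simp add: tensor_comult_def tensor_map_add middle_swap_add)

lemma tensor_counit_add:
  "tensor_counit \<epsilon> \<epsilon>' (x + y) = tensor_counit \<epsilon> \<epsilon>' x + tensor_counit \<epsilon> \<epsilon>' y"
  unfolding tensor_counit_def by (rule pm_lin_add) (auto simp: algebra_simps)

text \<open>A candidate for the multiplication is linear on \<open>free_on X\<close> only, being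
  undefined elsewhere, so \<open>additive_ext_on_free\<close> does not apply to it. Homogeneity
  reduces the comparison to coefficient 1.\<close>

lemma linear_on_free_ext:
  assumes "linear_on_free X f" "linear_on_free X g" "x \<in> free_on X"
    and "\<And>a. a \<in> X \<Longrightarrow> f (single a 1) = g (single a 1)"
  shows "f x = g x"
  using assms(3)
proof (induction rule: free_on_induct)
  case zero
  have 0: "0 \<in> free_on X" by (simp add: free_on_def)
  have "h 0 = 0" if "linear_on_free X h" for h
    using that 0 unfolding linear_on_free_def by (metis add_cancel_right_right add_0)
  then show ?case using assms(1,2) by metis
next
  case (single a c)
  then have "single a 1 \<in> free_on X" by (simp add: free_on_def)
  then have "h (single a c) = pm_scale (*) c (h (single a 1))" if "linear_on_free X h" for h
    using that unfolding linear_on_free_def by (metis scale_single mult.right_neutral)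
  from this[OF assms(1)] this[OF assms(2)] show ?case using assms(4)[OF single] by simp
next
  case (add x y)
  then show ?case using assms(1,2) by (simp add: linear_on_free_def)
qed


section \<open>The path coalgebra\<close>

lemma target_simps [simp]:
  "target Q (u, []) = u"
  "target Q (u, a # p) = target Q (head Q a, p)"
proof -
  have "pre_digraph.awalk_verts Q v p \<noteq> []" for v
    by (cases p) (simp_all add: pre_digraph.awalk_verts.simps)
  then show "target Q (u, []) = u" "target Q (u, a # p) = target Q (head Q a, p)"
    by (simp_all add: target_def pre_digraph.awalk_verts.simps)
qed

lemma paths_simps:
  "(u, []) \<in> paths (quiver E)"
  "(u, a # p) \<in> paths (quiver E) \<longleftrightarrow>
     a \<in> arcs (quiver E) \<and> tail (quiver E) a = u \<and> (head (quiver E) a, p) \<in> paths (quiver E)"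
  by (auto simp: paths_def pre_digraph.awalk_def pre_digraph.cas.simps quiver_def)

lemma paths_take_drop:
  assumes "(u, p) \<in> paths (quiver E)"
  shows "(u, take i p) \<in> paths (quiver E)" "(target (quiver E) (u, take i p), drop i p) \<in> paths (quiver E)"
  using assms by (induction p arbitrary: u i; case_tac i; simp add: paths_simps)+

lemma path_comult_add: "path_comult Q (x + y) = path_comult Q x + path_comult Q y"
  unfolding path_comult_def by (rule pm_lin_add) (auto simp: single_add sum.distrib)

lemma path_comult_single:
  "path_comult Q (single (u, p) r) =
     (\<Sum>i\<le>length p. single ((target Q (u, take i p), drop i p), (u, take i p)) r)"
  unfolding path_comult_def by (subst pm_lin_single) auto

text \<open>A pair of paths is a splitting of its concatenation and of no other path, and at one
  position only, the length of its right-hand part. Hence a single term of the double sum can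
  contribute.\<close>

lemma lookup_path_comult:
  "Poly_Mapping.lookup (path_comult Q x) ((w', es'), (w, es)) =
     (if w' = target Q (w, es) then Poly_Mapping.lookup x (w, es @ es') else 0)"
proof -
  have *: "(\<Sum>i\<le>length p. Poly_Mapping.lookup
          (single ((target Q (u, take i p), drop i p), (u, take i p)) r) ((w', es'), (w, es))) =
        (if (u, p) = (w, es @ es') then if w' = target Q (w, es) then r else 0 else 0)"
    (is "?l = ?r") for u p r
  proof -
    have "?l = (\<Sum>i\<le>length p. if i = length es then ?r else 0)"
    proof (intro sum.cong refl)
      fix i assume "i \<in> {..length p}"
      then have "take i p = es \<and> drop i p = es' \<longleftrightarrow> p = es @ es' \<and> i = length es"
        by auto
      then have "((target Q (u, take i p), drop i p), (u, take i p)) = ((w', es'), (w, es)) \<longleftrightarrow>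
          i = length es \<and> (u, p) = (w, es @ es') \<and> w' = target Q (w, es)"
        unfolding prod.inject by metis
      then show "Poly_Mapping.lookup
          (single ((target Q (u, take i p), drop i p), (u, take i p)) r) ((w', es'), (w, es)) =
          (if i = length es then ?r else 0)"
        unfolding lookup_single when_def by presburger
    qed
    also have "\<dots> = ?r" by (simp add: sum.delta)
    finally show ?thesis .
  qed
  have "Poly_Mapping.lookup (path_comult Q x) ((w', es'), (w, es)) =
      (\<Sum>a\<in>Poly_Mapping.keys x. if a = (w, es @ es') then
        if w' = target Q (w, es) then Poly_Mapping.lookup x a else 0 else 0)"
    unfolding path_comult_def lookup_pm_lin case_prod_unfold lookup_sum
    by (intro sum.cong refl) (simp only: * prod.collapse)
  also have "\<dots> = (if w' = target Q (w, es) then Poly_Mapping.lookup x (w, es @ es') else 0)"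
    by (rule sum_delta_keys) simp
  finally show ?thesis .
qed

lemma path_counit_add: "path_counit (x + y) = path_counit x + path_counit y"
  unfolding path_counit_def by (rule pm_lin_add) auto

lemma path_counit_eq_0: "(\<And>u. Poly_Mapping.lookup x (u, []) = 0) \<Longrightarrow> path_counit x = 0"
  unfolding path_counit_def pm_lin_def by (rule sum.neutral) auto

lemma path_counit_single: "path_counit (single (u, p) r) = (if p = [] then r else 0)"
  unfolding path_counit_def by (subst pm_lin_single) auto

lemma tensor_path_comult_single:
  "tensor_comult (path_comult Q) (path_comult Q) (single ((u, p), (v, q)) r) =
     (\<Sum>(i, j)\<in>{..length p} \<times> {..length q}.
        single (((target Q (u, take i p), drop i p), (target Q (v, take j q), drop j q)),
                ((u, take i p), (v, take j q))) r)"
proof -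
  have scale_sum: "pm_scale (*) r (\<Sum>i\<in>I. f i) = (\<Sum>i\<in>I. pm_scale (*) r (f i))" for I and f :: "_ \<Rightarrow> _ \<Rightarrow>\<^sub>0 _"
    by (rule poly_mapping_eqI) (simp add: lookup_sum sum_distrib_left)
  show ?thesis
    unfolding tensor_comult_def tensor_map_single path_comult_single tensor_sum_left
    unfolding tensor_sum_right sum.cartesian_product scale_sum
    by (simp add: case_prod_unfold middle_swap_sum_single)
qed

text \<open>Both paths are cut independently; the initial pieces feed the right-hand factor \<gamma>
  and the final pieces the left-hand factor \<gamma>'. In this form the coalgebra map condition is
  used both for existence and for uniqueness.\<close>

lemma lookup_tensor_map_path_comult:
  "Poly_Mapping.lookup
     (tensor_map f f (tensor_comult (path_comult Q) (path_comult Q) (single ((u, p), (v, q)) r))) (\<gamma>', \<gamma>) =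
   r * (\<Sum>i\<le>length p. \<Sum>j\<le>length q.
     Poly_Mapping.lookup (f (single ((u, take i p), (v, take j q)) 1)) \<gamma> *
     Poly_Mapping.lookup
       (f (single ((target Q (u, take i p), drop i p), (target Q (v, take j q), drop j q)) 1)) \<gamma>')"
  unfolding tensor_path_comult_single case_prod_unfold tensor_map_sum_single
  by (simp add: lookup_sum lookup_tensor sum.cartesian_product sum_distrib_left case_prod_unfold mult_ac)

lemma vertex_part_add: "vertex_part (x + y) = vertex_part x + vertex_part y"
  unfolding vertex_part_def by (rule pm_lin_add) (auto simp: single_add)

lemma vertex_part_single: "vertex_part (single (u, p) r) = (if p = [] then single u r else 0)"
  unfolding vertex_part_def by (subst pm_lin_single) auto

lemma lookup_vertex_part: "Poly_Mapping.lookup (vertex_part x) u = Poly_Mapping.lookup x (u, [])"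
proof -
  have "Poly_Mapping.lookup (vertex_part x) u =
      (\<Sum>a\<in>Poly_Mapping.keys x. if a = (u, []) then Poly_Mapping.lookup x a else 0)"
    unfolding vertex_part_def lookup_pm_lin
    by (intro sum.cong refl) (auto simp: lookup_single when_def split: prod.splits)
  also have "\<dots> = Poly_Mapping.lookup x (u, [])" by (rule sum_delta_keys)
  finally show ?thesis .
qed


section \<open>Thin sequences and thin splits\<close>

lemma finite_thin_seqs [simp]: "finite (thin_seqs n p)"
proof (rule finite_subset)
  show "thin_seqs n p \<subseteq> {d. set d \<subseteq> UNIV \<and> length d = p}" by (auto simp: thin_seqs_def)
qed (rule finite_lists_length_eq, simp)

lemma thin_seqs_0_0: "thin_seqs 0 0 = {[]}"
  by (auto simp: thin_seqs_def)

text \<open>Pascal's recursion, by the first entry: a leading one leaves one fewer one to place, a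
  leading zero one fewer zero. Positivity of the length makes \<open>hd\<close> meaningful.\<close>

lemma sum_thin_seqs:
  assumes "0 < n + m"
  shows "sum f (thin_seqs n (n + m)) =
     (case n of 0 \<Rightarrow> 0 | Suc n' \<Rightarrow> \<Sum>d\<in>thin_seqs n' (n' + m). f (True # d)) +
     (case m of 0 \<Rightarrow> 0 | Suc m' \<Rightarrow> \<Sum>d\<in>thin_seqs n (n + m'). f (False # d))"
proof -
  let ?T = "\<lambda>b. {d \<in> thin_seqs n (n + m). hd d = b}"
  have "sum f (thin_seqs n (n + m)) = sum f (?T True) + sum f (?T False)"
    by (subst sum.union_disjoint[symmetric]) (auto intro!: sum.cong)
  moreover have "sum f (?T True) = (case n of 0 \<Rightarrow> 0 | Suc n' \<Rightarrow> \<Sum>d\<in>thin_seqs n' (n' + m). f (True # d))"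
  proof (cases n)
    case 0
    have "?T True = {}" using assms unfolding 0
      by (auto simp: thin_seqs_def count_list_0_iff) (metis hd_in_set length_greater_0_conv)
    then show ?thesis by (simp only: 0) simp
  next
    case (Suc n')
    have "?T True = Cons True ` thin_seqs n' (n' + m)"
    proof (intro equalityI subsetI)
      fix d assume "d \<in> ?T True"
      then show "d \<in> Cons True ` thin_seqs n' (n' + m)" by (cases d) (auto simp: thin_seqs_def Suc)
    qed (auto simp: thin_seqs_def Suc)
    then show ?thesis by (simp only:) (simp add: sum.reindex Suc)
  qed
  moreover have "sum f (?T False) = (case m of 0 \<Rightarrow> 0 | Suc m' \<Rightarrow> \<Sum>d\<in>thin_seqs n (n + m'). f (False # d))"
  proof (cases m)
    case 0
    have "?T False = {}"
    proof -
      \<comment> \<open>A leading zero would leave \<open>n\<close> ones among \<open>n - 1\<close>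
        entries.\<close>
      have False if "d \<in> ?T False" for d
        using that assms count_le_length[of "tl d" True] by (cases d) (auto simp: thin_seqs_def 0)
      then show ?thesis by blast
    qed
    then show ?thesis by (simp only: 0) simp
  next
    case (Suc m')
    have "?T False = Cons False ` thin_seqs n (n + m')"
    proof (intro equalityI subsetI)
      fix d assume "d \<in> ?T False"
      then show "d \<in> Cons False ` thin_seqs n (n + m')" by (cases d) (auto simp: thin_seqs_def Suc)
    qed (auto simp: thin_seqs_def Suc)
    then show ?thesis by (simp only:) (simp add: sum.reindex Suc)
  qed
  ultimately show ?thesis by simp
qed

text \<open>Turns the definition by indices into a recursion: once the first arrow is used, its head
  plays the role of the source, and all later entries are read off the remaining path.\<close>

lemma thin_split_simps [simp]:
  "thin_split Q [] \<alpha> = []"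
  "thin_split Q (True # d) (u, a # p) = Inr a # thin_split Q d (head Q a, p)"
  "thin_split Q (False # d) (u, p) = Inl u # thin_split Q d (u, p)"
  by (auto simp: thin_split_def Let_def map_upt_Suc nth_Cons' simp del: upt_Suc)


section \<open>Coefficients of products\<close>

locale hopf_bimodule_bases = hopf_bimodule scale lact ract \<delta>\<^sub>L \<delta>\<^sub>R
  for scale :: "'k::field \<Rightarrow> 'b::ab_group_add \<Rightarrow> 'b"
    and lact :: "('g::group_add \<Rightarrow>\<^sub>0 'k) \<Rightarrow> 'b \<Rightarrow> 'b"
    and ract :: "'b \<Rightarrow> ('g \<Rightarrow>\<^sub>0 'k) \<Rightarrow> 'b"
    and \<delta>\<^sub>L \<delta>\<^sub>R :: "'b \<Rightarrow> ('g \<Rightarrow>\<^sub>0 'b)" +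
  fixes E :: "'g \<Rightarrow> 'g \<Rightarrow> 'b set"
  assumes bases: "isotypic_bases scale \<delta>\<^sub>L \<delta>\<^sub>R E"
begin

abbreviation Q :: "('g, 'b) pre_digraph" where "Q \<equiv> quiver E"

abbreviation rep :: "'b \<Rightarrow> 'b \<Rightarrow> 'k" where "rep \<equiv> representation (\<Union>y x. E y x)"

section \<open>Coordinates in the basis of arrows\<close>

lemma rep_add: "rep (b + b') e = rep b e + rep b' e"
  using representation_add[OF bases_independent[OF bases], of b' b] bases_span[OF bases]
  by (simp add: add.commute)

lemma rep_scale: "rep (scale c b) e = c * rep b e"
  using representation_scale[OF bases_independent[OF bases], of b c] bases_span[OF bases] by simp

lemma rep_arc: "a \<in> arcs Q \<Longrightarrow> rep a e = (if e = a then 1 else 0)"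
  using representation_basis[OF bases_independent[OF bases], of a] by (simp add: quiver_simps[OF bases])

lemma rep_eqI: assumes "\<And>e. e \<in> arcs Q \<Longrightarrow> rep b e = rep b' e" shows "b = b'"
proof -
  have "rep b e = rep b' e" for e
    using assms representation_ne_zero[of "\<Union>y x. E y x" _ e] unfolding quiver_simps(2)[OF bases] by metis
  then have eq: "rep b = rep b'" by (rule ext)
  have sum: "(\<Sum>e | rep x e \<noteq> 0. scale (rep x e) e) = x" for x
    using sum_nonzero_representation_eq[OF bases_independent[OF bases], of x] bases_span[OF bases] by simp
  show ?thesis using sum[of b] unfolding eq sum[of b'] by (rule sym)
qed

text \<open>On the span of \<open>E y x\<close>, coordinates in the union of all bases are those in
  \<open>E y x\<close> alone.\<close>

lemma rep_isotypic:
  assumes "b \<in> isotypic \<delta>\<^sub>L \<delta>\<^sub>R y x" "rep b e \<noteq> 0"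
  shows "e \<in> E y x"
proof -
  have "b \<in> span (E y x)" using assms(1) bases by (simp add: isotypic_bases_def)
  then have "rep b = representation (E y x) b"
    using representation_extend[OF bases_independent[OF bases], of b "E y x"] by blast
  then show ?thesis using assms(2) representation_ne_zero by metis
qed

section \<open>The actions of group elements on arrows\<close>

lemma act_zero [simp]: "lact a 0 = 0" "ract 0 a = 0" "lact 0 b = 0" "ract b 0 = 0"
  using lact_add_right[of a 0 0] ract_add_left[of 0 0 a] lact_add_left[of 0 0 b] ract_add_right[of b 0 0]
  by simp_all

text \<open>A scalar acts as a multiple of the unit of the group algebra, which is central, and
  therefore moves past group elements.\<close>

lemma lact_single_scale: "lact (single g c) (scale d b) = scale (c * d) (lact (single g 1) b)"
proof -
  have "lact (single g c) (scale d b) = lact (single g c * single 0 d) b"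
    by (simp only: lact_mult lact_scalar)
  also have "single g c * single 0 d = single 0 (c * d) * single g 1" by (simp add: mult_single)
  finally show ?thesis by (simp only: lact_mult lact_scalar)
qed

lemma ract_scale_single: "ract (scale d b) (single g c) = scale (d * c) (ract b (single g 1))"
proof -
  have "ract (scale d b) (single g c) = ract b (single 0 d * single g c)"
    by (simp only: ract_mult ract_scalar)
  also have "single 0 d * single g c = single g 1 * single 0 (d * c)" by (simp add: mult_single)
  finally show ?thesis by (simp only: ract_mult ract_scalar)
qed

text \<open>The coactions commute with the diagonal action, so translation by \<open>g\<close> moves
  both degrees of an isotypic component by \<open>g\<close>; only arrows of the translated component
  can occur.\<close>

lemma rep_lact:
  assumes "a \<in> arcs Q" "rep (lact (single g 1) a) e \<noteq> 0"
  shows "e \<in> arcs Q" "tail Q e = g + tail Q a" "head Q e = g + head Q a"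
proof -
  obtain y x where a: "a \<in> E y x" using assms(1) by (auto simp: quiver_simps[OF bases])
  then have "\<delta>\<^sub>L a = single y a" "\<delta>\<^sub>R a = single x a"
    using base_isotypic[OF bases] by (auto simp: isotypic_def)
  then have "lact (single g 1) a \<in> isotypic \<delta>\<^sub>L \<delta>\<^sub>R (g + y) (g + x)"
    by (simp add: isotypic_def left_coaction_lact right_coaction_lact diag_left_def pm_lin_single)
  then have "e \<in> E (g + y) (g + x)" by (rule rep_isotypic) (rule assms(2))
  then show "e \<in> arcs Q" "tail Q e = g + tail Q a" "head Q e = g + head Q a"
    using a by (auto simp: quiver_simps[OF bases])
qed

lemma rep_ract:
  assumes "a \<in> arcs Q" "rep (ract a (single g 1)) e \<noteq> 0"
  shows "e \<in> arcs Q" "tail Q e = tail Q a + g" "head Q e = head Q a + g"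
proof -
  obtain y x where a: "a \<in> E y x" using assms(1) by (auto simp: quiver_simps[OF bases])
  then have "\<delta>\<^sub>L a = single y a" "\<delta>\<^sub>R a = single x a"
    using base_isotypic[OF bases] by (auto simp: isotypic_def)
  then have "ract a (single g 1) \<in> isotypic \<delta>\<^sub>L \<delta>\<^sub>R (y + g) (x + g)"
    by (simp add: isotypic_def left_coaction_ract right_coaction_ract diag_right_def pm_lin_single)
  then have "e \<in> E (y + g) (x + g)" by (rule rep_isotypic) (rule assms(2))
  then show "e \<in> arcs Q" "tail Q e = tail Q a + g" "head Q e = head Q a + g"
    using a by (auto simp: quiver_simps[OF bases])
qed

section \<open>Coefficients of brackets\<close>

lemma lookup_of_bimodule:
  "Poly_Mapping.lookup (of_bimodule scale E b) (w, es) =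
     (case es of [e] \<Rightarrow> if w = tail Q e then rep b e else 0 | _ \<Rightarrow> 0)"
proof -
  have "Poly_Mapping.lookup (of_bimodule scale E b) (w, es) =
      (\<Sum>a | rep b a \<noteq> 0. rep b a when (tail Q a, [a]) = (w, es))"
    by (simp add: of_bimodule_def Let_def lookup_sum lookup_single)
  \<comment> \<open>For empty \<open>es\<close> the value of \<open>hd es\<close> is arbitrary, but
    then the equation of paths fails and both sides vanish.\<close>
  also have "\<dots> = (\<Sum>a | rep b a \<noteq> 0. if a = hd es then rep b a when (tail Q a, [a]) = (w, es) else 0)"
    by (intro sum.cong refl, cases es) (simp_all add: when_def)
  also have "\<dots> = (case es of [e] \<Rightarrow> if w = tail Q e then rep b e else 0 | _ \<Rightarrow> 0)"
    by (auto simp: finite_representation when_def split: list.splits)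
  finally show ?thesis .
qed

text \<open>Product of the coordinates along a path, read in order of traversal. The value 1 at two
  empty lists makes the recursion uniform; it differs from \<open>bracket scale E [] = 0\<close>, so
  \<open>lookup_bracket\<close> concerns nonempty lists.\<close>

fun bracket_coef :: "'b list \<Rightarrow> 'g \<Rightarrow> 'b list \<Rightarrow> 'k" where
  "bracket_coef [] w [] = 1"
| "bracket_coef (x # xs) w (e # es) =
     (if w = tail Q e then rep x e * bracket_coef xs (head Q e) es else 0)"
| "bracket_coef _ _ _ = 0"

text \<open>All basis paths in \<open>of_bimodule scale E x\<close> are single arrows, so a path
  arises only by attaching its first traversed arrow to the rest. The coefficient is thus one
  product and not a sum over splittings.\<close>

lemma lookup_path_concat_of_bimodule:
  "Poly_Mapping.lookup (path_concat Q y (of_bimodule scale E x)) (w, es) =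
     (case es of [] \<Rightarrow> 0 | e # es' \<Rightarrow>
       if w = tail Q e then rep x e * Poly_Mapping.lookup y (head Q e, es') else 0)"
proof -
  let ?x = "of_bimodule scale E x"
  have arrow: "\<exists>e. \<beta> = (tail Q e, [e])" if "\<beta> \<in> Poly_Mapping.keys ?x" for \<beta>
    using that by (cases \<beta>) (auto simp: in_keys_iff lookup_of_bimodule split: list.splits if_splits)
  have "Poly_Mapping.lookup (path_concat Q y ?x) (w, es) =
     (\<Sum>\<alpha>\<in>Poly_Mapping.keys y. \<Sum>\<beta>\<in>Poly_Mapping.keys ?x.
        if fst \<alpha> = target Q \<beta> \<and> (fst \<beta>, snd \<beta> @ snd \<alpha>) = (w, es)
        then Poly_Mapping.lookup y \<alpha> * Poly_Mapping.lookup ?x \<beta> else 0)"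
    unfolding path_concat_def lookup_pm_lin by (intro sum.cong refl) (simp add: lookup_single when_def)
  also have "\<dots> = (case es of [] \<Rightarrow> 0 | e # es' \<Rightarrow>
       if w = tail Q e then rep x e * Poly_Mapping.lookup y (head Q e, es') else 0)"
  proof (cases es)
    case Nil
    then show ?thesis using arrow by (fastforce intro!: sum.neutral)
  next
    case (Cons e es')
    have cond: "(fst \<alpha> = target Q \<beta> \<and> (fst \<beta>, snd \<beta> @ snd \<alpha>) = (w, es)) =
        (\<alpha> = (head Q e, es') \<and> \<beta> = (w, [e]))" if \<beta>: "\<beta> \<in> Poly_Mapping.keys ?x" for \<alpha> \<beta>
    proof -
      obtain e' where "\<beta> = (tail Q e', [e'])" using arrow[OF \<beta>] by blast
      then show ?thesis by (cases \<alpha>) (auto simp: Cons)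
    qed
    have "(\<Sum>\<alpha>\<in>Poly_Mapping.keys y. \<Sum>\<beta>\<in>Poly_Mapping.keys ?x.
        if fst \<alpha> = target Q \<beta> \<and> (fst \<beta>, snd \<beta> @ snd \<alpha>) = (w, es)
        then Poly_Mapping.lookup y \<alpha> * Poly_Mapping.lookup ?x \<beta> else 0) =
      (\<Sum>\<alpha>\<in>Poly_Mapping.keys y. \<Sum>\<beta>\<in>Poly_Mapping.keys ?x.
        if \<alpha> = (head Q e, es') \<and> \<beta> = (w, [e])
        then Poly_Mapping.lookup y \<alpha> * Poly_Mapping.lookup ?x \<beta> else 0)"
      by (intro sum.cong refl) (simp only: cond)
    also have "\<dots> =
      (\<Sum>\<alpha>\<in>Poly_Mapping.keys y. if \<alpha> = (head Q e, es') then
         (\<Sum>\<beta>\<in>Poly_Mapping.keys ?x. if \<beta> = (w, [e]) then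
            Poly_Mapping.lookup y \<alpha> * Poly_Mapping.lookup ?x \<beta> else 0) else 0)"
      by (intro sum.cong refl) simp
    also have "\<dots> = Poly_Mapping.lookup y (head Q e, es') * Poly_Mapping.lookup ?x (w, [e])"
      by (auto simp: in_keys_iff)
    finally show ?thesis by (simp add: Cons lookup_of_bimodule)
  qed
  finally show ?thesis .
qed

lemma lookup_bracket:
  "xs \<noteq> [] \<Longrightarrow> Poly_Mapping.lookup (bracket scale E xs) (w, es) = bracket_coef xs w es"
proof (induction xs arbitrary: w es rule: induct_list012)
  case (2 x)
  have "bracket_coef [] w' es' = (if es' = [] then 1 else 0)" for w' es' by (cases es') simp_all
  then show ?case by (cases es) (auto simp: lookup_of_bimodule split: list.splits)
next
  case (3 x y zs)
  then show ?case by (cases es) (simp_all add: lookup_path_concat_of_bimodule)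
qed simp

text \<open>
  The coefficient of the path \<open>(w, es)\<close> in the product of \<open>(u, p)\<close> and \<open>(v, q)\<close>.  The condition
  \<open>w = u + v\<close> is automatic along paths as soon as \<open>es\<close> is nonempty; imposing it at every step
  makes \<open>coef_append\<close> hold for arbitrary lists \<open>p\<close> and \<open>q\<close>.
\<close>

primrec coef :: "'b list \<Rightarrow> 'g \<Rightarrow> 'b list \<Rightarrow> 'g \<Rightarrow> 'b list \<Rightarrow> 'g \<Rightarrow> 'k" where
  "coef [] = (\<lambda>u p v q w. if p = [] \<and> q = [] \<and> w = u + v then 1 else 0)"
| "coef (e # es) = (\<lambda>u p v q w.
     if w = u + v \<and> w = tail Q e then
       (case p of [] \<Rightarrow> 0 | a # p' \<Rightarrow> rep (ract a (single v 1)) e * coef es (head Q a) p' v q (head Q e)) +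
       (case q of [] \<Rightarrow> 0 | b # q' \<Rightarrow> rep (lact (single u 1) b) e * coef es u p (head Q b) q' (head Q e))
     else 0)"

section \<open>Support and splitting of the product coefficients\<close>

lemma coef_nonzero_source: "coef es u p v q w \<noteq> 0 \<Longrightarrow> w = u + v"
  by (cases es) (auto split: if_splits)

text \<open>A nonzero sum has a nonzero summand, so at least one way of producing the first arrow
  \<open>e\<close> survives; inductions on \<open>es\<close> follow that branch.\<close>

lemma coef_Cons_nonzeroE:
  assumes "coef (e # es) u p v q w \<noteq> 0"
  obtains (left) a p' where "p = a # p'" "w = tail Q e"
      "rep (ract a (single v 1)) e \<noteq> 0" "coef es (head Q a) p' v q (head Q e) \<noteq> 0"
    | (right) b q' where "q = b # q'" "w = tail Q e"
      "rep (lact (single u 1) b) e \<noteq> 0" "coef es u p (head Q b) q' (head Q e) \<noteq> 0"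
proof -
  have c: "w = u + v \<and> w = tail Q e" using assms by (auto split: if_splits)
  then consider
      "(case p of [] \<Rightarrow> 0 | a # p' \<Rightarrow> rep (ract a (single v 1)) e * coef es (head Q a) p' v q (head Q e)) \<noteq> 0"
    | "(case q of [] \<Rightarrow> 0 | b # q' \<Rightarrow> rep (lact (single u 1) b) e * coef es u p (head Q b) q' (head Q e)) \<noteq> 0"
    using assms unfolding coef.simps by fastforce
  then show thesis
  proof cases
    case 1
    then show thesis using left c by (auto split: list.splits)
  next
    case 2
    then show thesis using right c by (auto split: list.splits)
  qed
qed

text \<open>Each step consumes an arrow of \<open>p\<close> or of \<open>q\<close>, which changes
  neither target. At the end both paths are vertices and \<open>w = u + v\<close>.\<close>

lemma coef_nonzero_target:
  "coef es u p v q w \<noteq> 0 \<Longrightarrow> target Q (w, es) = target Q (u, p) + target Q (v, q)"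
proof (induction es arbitrary: u p v q w)
  case (Cons e es)
  from Cons.prems show ?case
    by (cases rule: coef_Cons_nonzeroE) (use Cons.IH in fastforce)+
qed (auto split: if_splits)

lemma coef_nonzero_path:
  "coef es u p v q w \<noteq> 0 \<Longrightarrow> (w, es) \<in> paths Q"
proof (induction es arbitrary: u p v q w)
  case (Cons e es)
  have arc: "e \<in> arcs Q" if "rep b e \<noteq> 0" for b
    using representation_ne_zero[OF that] by (simp add: quiver_simps(2)[OF bases])
  from Cons.prems show ?case
  proof (cases rule: coef_Cons_nonzeroE)
    case (left a p')
    then show ?thesis using Cons.IH[OF left(4)] arc by (simp add: paths_simps)
  next
    case (right b q')
    then show ?thesis using Cons.IH[OF right(4)] arc by (simp add: paths_simps)
  qed
qed (simp add: paths_simps)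

text \<open>Multiplicativity of the comultiplication in coefficients: \<open>i\<close> and
  \<open>j\<close> count the arrows of \<open>p\<close> and \<open>q\<close> consumed while
  \<open>es\<close> is read. If \<open>w'\<close> is not the target of \<open>(w, es)\<close>, the
  first factor forces the sum of the intermediate targets to be that target and the second forces it
  to be \<open>w'\<close>, so every term vanishes.\<close>

lemma coef_append:
  "(\<Sum>i\<le>length p. \<Sum>j\<le>length q. coef es u (take i p) v (take j q) w *
      coef es' (target Q (u, take i p)) (drop i p) (target Q (v, take j q)) (drop j q) w') =
   (if w' = target Q (w, es) then coef (es @ es') u p v q w else 0)"
proof (cases "w' = target Q (w, es)")
  case False
  then have "coef es u (take i p) v (take j q) w *
      coef es' (target Q (u, take i p)) (drop i p) (target Q (v, take j q)) (drop j q) w' = 0" for i j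
    using coef_nonzero_target coef_nonzero_source by (metis mult_eq_0_iff)
  then show ?thesis by (simp only: False if_False sum.neutral_const)
next
  case True
  have "(\<Sum>i\<le>length p. \<Sum>j\<le>length q. coef es u (take i p) v (take j q) w *
      coef es' (target Q (u, take i p)) (drop i p) (target Q (v, take j q)) (drop j q) (target Q (w, es))) =
    coef (es @ es') u p v q w"
  proof (induction es arbitrary: u p v q w)
    case Nil
    \<comment> \<open>Nothing has been consumed yet, so only \<open>i = j = 0\<close> contributes;
      \<open>coef_nonzero_source\<close> supplies the condition \<open>w = u + v\<close>.\<close>
    have "coef [] u (take i p) v (take j q) w *
        coef es' (target Q (u, take i p)) (drop i p) (target Q (v, take j q)) (drop j q) w =
      (if j = 0 then if i = 0 then coef es' u p v q w else 0 else 0)"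
      if "i \<le> length p" "j \<le> length q" for i j
      using that coef_nonzero_source[of es' u p v q w] by auto
    then have "(\<Sum>i\<le>length p. \<Sum>j\<le>length q. coef [] u (take i p) v (take j q) w *
        coef es' (target Q (u, take i p)) (drop i p) (target Q (v, take j q)) (drop j q) w) =
      (\<Sum>i\<le>length p. \<Sum>j\<le>length q. if j = 0 then if i = 0 then coef es' u p v q w else 0 else 0)"
      by (intro sum.cong refl) (simp only: atMost_iff)
    also have "\<dots> = coef es' u p v q w" by simp
    finally show ?case by (simp only: target_simps append_Nil)
  next
    case (Cons e es)
    let ?c = "\<lambda>u p v q w i j. coef es u (take i p) v (take j q) w *
      coef es' (target Q (u, take i p)) (drop i p) (target Q (v, take j q)) (drop j q) (target Q (w, es))"
    show ?case
    proof (cases "w = u + v \<and> w = tail Q e")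
      case c: True
      \<comment> \<open>\<open>?L\<close> and \<open>?R\<close> are the branches in which
        \<open>e\<close> comes from the first arrow of \<open>p\<close> and of
        \<open>q\<close>.\<close>
      let ?L = "\<lambda>i j. case take i p of [] \<Rightarrow> 0
        | a # p' \<Rightarrow> rep (ract a (single v 1)) e * coef es (head Q a) p' v (take j q) (head Q e)"
      let ?R = "\<lambda>i j. case take j q of [] \<Rightarrow> 0
        | b # q' \<Rightarrow> rep (lact (single u 1) b) e * coef es u (take i p) (head Q b) q' (head Q e)"
      let ?X = "\<lambda>i j. coef es' (target Q (u, take i p)) (drop i p) (target Q (v, take j q)) (drop j q)
        (target Q (head Q e, es))"
      have "(\<Sum>i\<le>length p. \<Sum>j\<le>length q. ?L i j * ?X i j) =
          (case p of [] \<Rightarrow> 0 | a # p' \<Rightarrow>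
            rep (ract a (single v 1)) e * coef (es @ es') (head Q a) p' v q (head Q e))"
      proof (cases p)
        case p: (Cons a p')
        \<comment> \<open>The term \<open>i = 0\<close> vanishes because no arrow of
          \<open>p\<close> is available; shifting \<open>i\<close> by one leaves the double sum of
          the induction hypothesis for \<open>p'\<close>.\<close>
        show ?thesis
          unfolding p Cons.IH[symmetric] list.size(4) add_0_right plus_nat.simps
          by (simp only: One_nat_def add_Suc_right add_0_right sum.atMost_Suc_shift)
            (simp add: sum_distrib_left mult.assoc)
      qed simp
      moreover have "(\<Sum>i\<le>length p. \<Sum>j\<le>length q. ?R i j * ?X i j) =
          (case q of [] \<Rightarrow> 0 | b # q' \<Rightarrow>
            rep (lact (single u 1) b) e * coef (es @ es') u p (head Q b) q' (head Q e))"
      proof (cases q)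
        case q: (Cons b q')
        show ?thesis
          unfolding q Cons.IH[symmetric] list.size(4) add_0_right plus_nat.simps
          by (simp only: One_nat_def add_Suc_right add_0_right sum.atMost_Suc_shift)
            (simp add: sum_distrib_left mult.assoc)
      qed simp
      ultimately show ?thesis
        using c by (simp add: distrib_right sum.distrib)
    next
      case False
      \<comment> \<open>The failing condition does not involve the lists, so it also kills the
        coefficients of all truncated paths.\<close>
      then have "coef (e # es) u p v q w = 0" for es p q by auto
      then show ?thesis by (simp only: append_Cons mult_zero_left sum.neutral_const)
    qed
  qed
  then show ?thesis using True by simp
qed


subsection \<open>Sums of thin products\<close>

abbreviation factors :: "'g \<Rightarrow> 'b list \<Rightarrow> 'g \<Rightarrow> 'b list \<Rightarrow> bool list \<Rightarrow> 'b list" where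
  "factors u p v q d \<equiv> map2 (thin_factor lact ract) (thin_split Q d (u, p)) (thin_split Q (map Not d) (v, q))"

text \<open>Both sides obey one recursion along \<open>es\<close>: a leading one in \<open>d\<close>
  lets \<open>v\<close> act on the first arrow of \<open>p\<close>, a leading zero lets
  \<open>u\<close> act on the first arrow of \<open>q\<close>. The guard \<open>w = u + v\<close>
  matches the one in \<open>coef\<close>.\<close>

lemma sum_bracket_coef_factors:
  assumes "(u, p) \<in> paths Q" "(v, q) \<in> paths Q"
  shows "(\<Sum>d\<in>thin_seqs (length p) (length p + length q).
      if w = u + v then bracket_coef (factors u p v q d) w es else 0) = coef es u p v q w"
  using assms
proof (induction es arbitrary: u p v q w)
  case Nil
  show ?case
  proof (cases "p = [] \<and> q = []")
    case True
    then show ?thesis by (auto simp: thin_seqs_0_0)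
  next
    case False
    have "bracket_coef (factors u p v q d) w [] = 0" if "d \<in> thin_seqs (length p) (length p + length q)" for d
    proof -
      have "length (factors u p v q d) = length p + length q"
        using that by (simp add: thin_split_def thin_seqs_def)
      then show ?thesis using False by (cases "factors u p v q d") auto
    qed
    then show ?thesis using False by (auto intro!: sum.neutral)
  qed
next
  case (Cons e es)
  show ?case
  proof (cases "p = [] \<and> q = []")
    case True
    then have "thin_seqs (length p) (length p + length q) = {[]}" by (simp add: thin_seqs_0_0)
    moreover have "coef (e # es) u p v q w = 0" using True by simp
    ultimately show ?thesis
      by (simp only: sum.insert finite.emptyI empty_iff not_False_eq_True sum.empty) simp
  next
    case False
    then have pos: "0 < length p + length q" by auto
    show ?thesis
    proof (cases "w = u + v \<and> w = tail Q e")
      case False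
      have "(if w = u + v then bracket_coef (factors u p v q d) w (e # es) else 0) = 0" for d
        using False by (cases "factors u p v q d") auto
      then show ?thesis using False by (simp only: sum.neutral_const) auto
    next
      case c: True
      then have w: "w = u + v" "tail Q e = u + v" by metis+
      have True_step: "(\<Sum>d\<in>thin_seqs (length p') (length p' + length q).
          bracket_coef (factors u p v q (True # d)) w (e # es)) =
        rep (ract a (single v 1)) e * coef es (head Q a) p' v q (head Q e)" if p: "p = a # p'" for a p'
      proof (cases "rep (ract a (single v 1)) e = 0")
        case False
        have a: "a \<in> arcs Q" "(head Q a, p') \<in> paths Q" using Cons.prems(1) by (auto simp: p paths_simps)
        \<comment> \<open>An arrow \<open>e\<close> occurring in \<open>a.v\<close> ends at
          \<open>head Q a + v\<close>, which is the guard of the induction hypothesis at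
          \<open>head Q e\<close>.\<close>
        show ?thesis
          using rep_ract(3)[OF a(1) False]
          by (simp add: p w sum_distrib_left flip: Cons.IH[OF a(2) Cons.prems(2)])
      qed (simp add: p w)
      have False_step: "(\<Sum>d\<in>thin_seqs (length p) (length p + length q').
          bracket_coef (factors u p v q (False # d)) w (e # es)) =
        rep (lact (single u 1) b) e * coef es u p (head Q b) q' (head Q e)" if q: "q = b # q'" for b q'
      proof (cases "rep (lact (single u 1) b) e = 0")
        case False
        have b: "b \<in> arcs Q" "(head Q b, q') \<in> paths Q" using Cons.prems(2) by (auto simp: q paths_simps)
        show ?thesis
          using rep_lact(3)[OF b(1) False]
          by (simp add: q w sum_distrib_left flip: Cons.IH[OF Cons.prems(1) b(2)])
      qed (simp add: q w)
      have "(\<Sum>d\<in>thin_seqs (length p) (length p + length q).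
          if w = u + v then bracket_coef (factors u p v q d) w (e # es) else 0) =
        (\<Sum>d\<in>thin_seqs (length p) (length p + length q). bracket_coef (factors u p v q d) w (e # es))"
        using c by simp
      also have "\<dots> = coef (e # es) u p v q w"
        unfolding sum_thin_seqs[OF pos] coef.simps if_P[OF c]
      proof (rule arg_cong2[where f = "(+)"], goal_cases)
        case 1
        show ?case
        proof (cases p)
          case (Cons a p')
          then show ?thesis using True_step[OF Cons] by simp
        qed simp
      next
        case 2
        show ?case
        proof (cases q)
          case (Cons b q')
          then show ?thesis using False_step[OF Cons] by simp
        qed simp
      qed
      finally show ?thesis .
    qed
  qed
qed

text \<open>The first factor is an arrow from \<open>u\<close> acted on by \<open>v\<close>, or an
  arrow from \<open>v\<close> acted on by \<open>u\<close>; either way its components start at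
  \<open>u + v\<close>. So the guard above is automatic for nonempty \<open>d\<close>.\<close>

lemma bracket_coef_factors_source:
  assumes "(u, p) \<in> paths Q" "(v, q) \<in> paths Q" "d \<in> thin_seqs (length p) (length p + length q)" "d \<noteq> []"
    and "bracket_coef (factors u p v q d) w es \<noteq> 0"
  shows "w = u + v"
proof -
  obtain b d' where d: "d = b # d'" using assms(4) by (cases d) auto
  show ?thesis
  proof (cases b)
    case True
    with assms(3) d obtain a p' where p: "p = a # p'" by (cases p) (auto simp: thin_seqs_def)
    have "a \<in> arcs Q" "tail Q a = u" using assms(1) by (auto simp: p paths_simps)
    then show ?thesis
      using assms(5) rep_ract(2)[of a v] by (cases es) (auto simp: d True p split: if_splits)
  next
    case False
    \<comment> \<open>If \<open>q\<close> were empty, every entry of \<open>d\<close> would be a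
      one, against the leading zero.\<close>
    have "count_list d' True \<le> length d'" by (rule count_le_length)
    with assms(3) d False obtain a q' where q: "q = a # q'" by (cases q) (auto simp: thin_seqs_def)
    have "a \<in> arcs Q" "tail Q a = v" using assms(2) by (auto simp: q paths_simps)
    then show ?thesis
      using assms(5) rep_lact(2)[of a u] by (cases es) (auto simp: d False q split: if_splits)
  qed
qed

definition thin_sum :: "('g, 'b) path \<Rightarrow> ('g, 'b) path \<Rightarrow> (('g, 'b) path \<Rightarrow>\<^sub>0 'k)" where
  "thin_sum \<alpha> \<beta> = (\<Sum>d\<in>thin_seqs (length (snd \<alpha>)) (length (snd \<alpha>) + length (snd \<beta>)).
     thin_product scale lact ract E \<alpha> \<beta> d)"

text \<open>Two vertices are treated apart, since the empty sequence gives a product in the group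
  and not a bracket. Otherwise the guard \<open>w = u + v\<close> may be inserted in every
  term.\<close>

lemma lookup_thin_sum:
  assumes "(u, p) \<in> paths Q" "(v, q) \<in> paths Q"
  shows "Poly_Mapping.lookup (thin_sum (u, p) (v, q)) (w, es) = coef es u p v q w"
proof (cases "p = [] \<and> q = []")
  case True
  then show ?thesis
    by (cases es) (auto simp: thin_sum_def thin_seqs_0_0 thin_product_def lookup_single)
next
  case False
  have "Poly_Mapping.lookup (thin_product scale lact ract E (u, p) (v, q) d) (w, es) =
      (if w = u + v then bracket_coef (factors u p v q d) w es else 0)"
    if d: "d \<in> thin_seqs (length p) (length p + length q)" for d
  proof -
    have ne: "d \<noteq> []" "factors u p v q d \<noteq> []"
      using d False by (auto simp: thin_split_def thin_seqs_def)
    then show ?thesis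
      using bracket_coef_factors_source[OF assms d] by (auto simp: thin_product_def lookup_bracket)
  qed
  then show ?thesis
    by (simp add: thin_sum_def lookup_sum flip: sum_bracket_coef_factors[OF assms])
qed


section \<open>The multiplication\<close>

text \<open>Extended over all pairs, whether or not they are paths, so that it is additive on the
  whole type; it is restricted to \<open>free_on (paths Q \<times> paths Q)\<close> only at the
  end.\<close>

definition thin_mult :: "(('g, 'b) path \<times> ('g, 'b) path \<Rightarrow>\<^sub>0 'k) \<Rightarrow> (('g, 'b) path \<Rightarrow>\<^sub>0 'k)" where
  "thin_mult = pm_lin (\<lambda>(\<alpha>, \<beta>) r. pm_scale (*) r (thin_sum \<alpha> \<beta>))"

lemma thin_mult_add: "thin_mult (x + y) = thin_mult x + thin_mult y"
  unfolding thin_mult_def by (rule pm_lin_add) (auto simp: scale_add)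

lemma thin_mult_single: "thin_mult (single (\<alpha>, \<beta>) r) = pm_scale (*) r (thin_sum \<alpha> \<beta>)"
  unfolding thin_mult_def by (subst pm_lin_single) (auto simp: scale_add)

lemma thin_mult_scale: "thin_mult (pm_scale (*) c x) = pm_scale (*) c (thin_mult x)"
proof (rule additive_ext_on_free[where X = UNIV and f = "\<lambda>x. thin_mult (pm_scale (*) c x)"
      and g = "\<lambda>x. pm_scale (*) c (thin_mult x)"])
  fix a r show "thin_mult (pm_scale (*) c (single a r)) = pm_scale (*) c (thin_mult (single a r))"
    by (cases a) (auto simp: thin_mult_single intro!: poly_mapping_eqI)
qed (simp_all add: free_on_def thin_mult_add scale_add)

lemma lookup_thin_mult_single:
  assumes "(u, p) \<in> paths Q" "(v, q) \<in> paths Q"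
  shows "Poly_Mapping.lookup (thin_mult (single ((u, p), (v, q)) r)) (w, es) = r * coef es u p v q w"
  by (simp add: thin_mult_single lookup_thin_sum[OF assms])

section \<open>Compatibility with the coalgebra structures\<close>

lemma thin_mult_closed:
  assumes "x \<in> free_on (paths Q \<times> paths Q)"
  shows "thin_mult x \<in> free_on (paths Q)"
  using assms
proof (induction rule: free_on_induct)
  case zero
  show ?case by (simp add: thin_mult_def pm_lin_def free_on_def)
next
  case (single a c)
  then obtain u p v q where a: "a = ((u, p), (v, q))" "(u, p) \<in> paths Q" "(v, q) \<in> paths Q" by auto
  have "Poly_Mapping.keys (thin_mult (single a c)) \<subseteq> paths Q"
  proof
    fix \<gamma> assume "\<gamma> \<in> Poly_Mapping.keys (thin_mult (single a c))"
    then show "\<gamma> \<in> paths Q"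
      using coef_nonzero_path by (cases \<gamma>) (auto simp: in_keys_iff a lookup_thin_mult_single)
  qed
  then show ?case by (simp add: free_on_def)
qed (simp add: thin_mult_add free_on_add)

text \<open>On basis elements, the coefficient on the left is that of the path
  \<open>es @ es'\<close>, the one on the right is the double sum over cuts, and
  \<open>coef_append\<close> equates them.\<close>

lemma comult_thin_mult:
  assumes "x \<in> free_on (paths Q \<times> paths Q)"
  shows "path_comult Q (thin_mult x) =
    tensor_map thin_mult thin_mult (tensor_comult (path_comult Q) (path_comult Q) x)"
  using assms
proof (rule additive_ext_on_free)
  fix a :: "('g, 'b) path \<times> ('g, 'b) path" and r :: 'k
  assume "a \<in> paths Q \<times> paths Q"
  then obtain u p v q where a: "a = ((u, p), (v, q))" "(u, p) \<in> paths Q" "(v, q) \<in> paths Q" by auto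
  show "path_comult Q (thin_mult (single a r)) =
    tensor_map thin_mult thin_mult (tensor_comult (path_comult Q) (path_comult Q) (single a r))"
  proof (rule poly_mapping_eqI)
    fix k :: "('g, 'b) path \<times> ('g, 'b) path"
    obtain w' es' w es where k: "k = ((w', es'), (w, es))" by (cases k) auto
    show "Poly_Mapping.lookup (path_comult Q (thin_mult (single a r))) k =
      Poly_Mapping.lookup
        (tensor_map thin_mult thin_mult (tensor_comult (path_comult Q) (path_comult Q) (single a r))) k"
      unfolding k a(1) lookup_path_comult lookup_tensor_map_path_comult
      by (simp add: lookup_thin_mult_single[OF a(2,3)] lookup_thin_mult_single paths_take_drop[OF a(2)]
          paths_take_drop[OF a(3)] coef_append)
  qed
qed (simp_all add: thin_mult_add path_comult_add tensor_comult_add tensor_map_add)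

lemma counit_thin_mult:
  assumes "x \<in> free_on (paths Q \<times> paths Q)"
  shows "path_counit (thin_mult x) = tensor_counit path_counit path_counit x"
  using assms
proof (rule additive_ext_on_free)
  fix a :: "('g, 'b) path \<times> ('g, 'b) path" and r :: 'k
  assume "a \<in> paths Q \<times> paths Q"
  then obtain u p v q where a: "a = ((u, p), (v, q))" "(u, p) \<in> paths Q" "(v, q) \<in> paths Q" by auto
  have "path_counit (thin_mult (single a r)) = (if p = [] \<and> q = [] then r else 0)"
  proof (cases "p = [] \<and> q = []")
    case True
    then show ?thesis
      by (auto simp: a thin_mult_single thin_sum_def thin_seqs_0_0 thin_product_def path_counit_single)
  next
    case False
    have "path_counit (thin_mult (single a r)) = 0"
      by (rule path_counit_eq_0) (use False in \<open>auto simp: a lookup_thin_mult_single\<close>)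
    then show ?thesis by (simp only: False if_False)
  qed
  also have "\<dots> = tensor_counit path_counit path_counit (single a r)"
    unfolding tensor_counit_def by (subst pm_lin_single) (auto simp: a path_counit_single)
  finally show "path_counit (thin_mult (single a r)) = tensor_counit path_counit path_counit (single a r)" .
qed (simp_all add: thin_mult_add path_counit_add tensor_counit_add)

section \<open>Components in kG and in B\<close>

lemma vertex_part_thin_mult:
  assumes "x \<in> free_on (paths Q)" "y \<in> free_on (paths Q)"
  shows "vertex_part (thin_mult (tensor x y)) = vertex_part x * vertex_part y"
  using assms(1)
proof (rule additive_ext_on_free)
  fix \<alpha> c assume \<alpha>: "\<alpha> \<in> paths Q"
  show "vertex_part (thin_mult (tensor (single \<alpha> c) y)) = vertex_part (single \<alpha> c) * vertex_part y"
    using assms(2)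
  proof (rule additive_ext_on_free)
    fix \<beta> d assume \<beta>: "\<beta> \<in> paths Q"
    obtain u p v q where "\<alpha> = (u, p)" "\<beta> = (v, q)" by fastforce
    then show "vertex_part (thin_mult (tensor (single \<alpha> c) (single \<beta> d))) =
        vertex_part (single \<alpha> c) * vertex_part (single \<beta> d)"
      using \<alpha> \<beta> by (auto intro!: poly_mapping_eqI
          simp: lookup_vertex_part lookup_thin_mult_single vertex_part_single mult_single lookup_single)
  qed (simp_all add: tensor_add thin_mult_add vertex_part_add algebra_simps)
qed (simp_all add: tensor_add thin_mult_add vertex_part_add algebra_simps)

lemma arrow_part_add: "arrow_part scale (x + y) = arrow_part scale x + arrow_part scale y"
  unfolding arrow_part_def
  by (rule pm_lin_add) (auto simp: scale_left_distrib split: list.splits)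

lemma arrow_part_single:
  "arrow_part scale (single (u, p) r) = (case p of [a] \<Rightarrow> scale r a | _ \<Rightarrow> 0)"
  unfolding arrow_part_def by (subst pm_lin_single) (auto split: list.splits)

text \<open>Among paths, \<open>e\<close> alone forms a path from \<open>tail Q e\<close> only, so
  one coefficient of \<open>x\<close> carries the whole coordinate.\<close>

lemma rep_arrow_part:
  assumes "x \<in> free_on (paths Q)" "e \<in> arcs Q"
  shows "rep (arrow_part scale x) e = Poly_Mapping.lookup x (tail Q e, [e])"
  using assms(1)
proof (rule additive_ext_on_free)
  fix \<alpha> c assume \<alpha>: "\<alpha> \<in> paths Q"
  obtain u p where "\<alpha> = (u, p)" by fastforce
  then show "rep (arrow_part scale (single \<alpha> c)) e = Poly_Mapping.lookup (single \<alpha> c) (tail Q e, [e])"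
    using \<alpha> by (auto simp: arrow_part_single rep_scale rep_arc representation_zero paths_simps
        lookup_single when_def split: list.splits if_splits)
qed (simp_all add: arrow_part_add rep_add lookup_add)

text \<open>By biadditivity and coordinates this reduces to \<open>coef [e]\<close>, which is
  nonzero only for an arrow and a vertex in either order, giving one of the two actions.\<close>

lemma arrow_part_thin_mult:
  assumes "x \<in> free_on (paths Q)" "y \<in> free_on (paths Q)"
  shows "arrow_part scale (thin_mult (tensor x y)) =
    lact (vertex_part x) (arrow_part scale y) + ract (arrow_part scale x) (vertex_part y)"
  using assms(1)
proof (rule additive_ext_on_free)
  fix \<alpha> c assume \<alpha>: "\<alpha> \<in> paths Q"
  show "arrow_part scale (thin_mult (tensor (single \<alpha> c) y)) =
    lact (vertex_part (single \<alpha> c)) (arrow_part scale y) +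
    ract (arrow_part scale (single \<alpha> c)) (vertex_part y)"
    using assms(2)
  proof (rule additive_ext_on_free)
    fix \<beta> d assume \<beta>: "\<beta> \<in> paths Q"
    obtain u p v q where ab: "\<alpha> = (u, p)" "\<beta> = (v, q)" by fastforce
    show "arrow_part scale (thin_mult (tensor (single \<alpha> c) (single \<beta> d))) =
      lact (vertex_part (single \<alpha> c)) (arrow_part scale (single \<beta> d)) +
      ract (arrow_part scale (single \<alpha> c)) (vertex_part (single \<beta> d))" (is "?l = ?r")
    proof (rule rep_eqI)
      fix e assume e: "e \<in> arcs Q"
      have "thin_mult (single (\<alpha>, \<beta>) (c * d)) \<in> free_on (paths Q)"
        using \<alpha> \<beta> by (intro thin_mult_closed) (auto simp: free_on_def)
      then have "rep ?l e = c * d * coef [e] u p v q (tail Q e)"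
        using \<alpha> \<beta> by (simp add: rep_arrow_part e ab lookup_thin_mult_single)
      also have "\<dots> = rep ?r e"
      proof -
        \<comment> \<open>Both guards in \<open>coef [e]\<close> hold wherever the coordinate is
          nonzero, by the known tail and head of the translated arrow.\<close>
        have L: "rep (lact (single u 1) b) e * coef [] u [] (head Q b) [] (head Q e) =
            rep (lact (single u 1) b) e \<and> (rep (lact (single u 1) b) e \<noteq> 0 \<longrightarrow> tail Q e = u + v)"
          if "q = [b]" for b
          using that \<beta> rep_lact[of b u e] by (auto simp: ab paths_simps)
        have R: "rep (ract a (single v 1)) e * coef [] (head Q a) [] v [] (head Q e) =
            rep (ract a (single v 1)) e \<and> (rep (ract a (single v 1)) e \<noteq> 0 \<longrightarrow> tail Q e = u + v)"
          if "p = [a]" for a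
          using that \<alpha> rep_ract[of a v e] by (auto simp: ab paths_simps)
        show ?thesis
          using L R unfolding ab vertex_part_single arrow_part_single
          by (auto simp: rep_add lact_single_scale ract_scale_single rep_scale representation_zero
              split: list.splits)
      qed
      finally show "rep ?l e = rep ?r e" .
    qed
  qed (simp_all add: tensor_add thin_mult_add vertex_part_add arrow_part_add
      lact_add_left lact_add_right ract_add_left ract_add_right)
qed (simp_all add: tensor_add thin_mult_add vertex_part_add arrow_part_add
    lact_add_left lact_add_right ract_add_left ract_add_right)

section \<open>Existence and uniqueness of the multiplication\<close>

lemma is_cotensor_mult_thin_mult:
  "is_cotensor_mult scale lact ract E (restrict thin_mult (free_on (paths Q \<times> paths Q)))"
proof -
  let ?X = "paths Q \<times> paths Q"
  let ?f = "restrict thin_mult (free_on ?X)"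
  \<comment> \<open>After comultiplication only pairs of subpaths are evaluated, and there the
    restriction agrees with \<open>thin_mult\<close>.\<close>
  have "tensor_map ?f ?f (tensor_comult (path_comult Q) (path_comult Q) x) =
      tensor_map thin_mult thin_mult (tensor_comult (path_comult Q) (path_comult Q) x)"
    if "x \<in> free_on ?X" for x
    using that
  proof (rule additive_ext_on_free)
    fix a and r :: 'k assume "a \<in> ?X"
    then obtain u p v q where a: "a = ((u, p), (v, q))" "(u, p) \<in> paths Q" "(v, q) \<in> paths Q" by auto
    have "single ((u, take i p), (v, take j q)) (1::'k) \<in> free_on ?X"
      "single ((target Q (u, take i p), drop i p), (target Q (v, take j q), drop j q)) (1::'k) \<in> free_on ?X"
      for i j
      using paths_take_drop[OF a(2)] paths_take_drop[OF a(3)] by (auto simp: free_on_def)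
    then show "tensor_map ?f ?f (tensor_comult (path_comult Q) (path_comult Q) (single a r)) =
      tensor_map thin_mult thin_mult (tensor_comult (path_comult Q) (path_comult Q) (single a r))"
      by (intro poly_mapping_eqI)
        (simp add: a(1) lookup_tensor_map_path_comult split_paired_all)
  qed (simp_all add: tensor_comult_add tensor_map_add)
  moreover have "x + y \<in> free_on ?X" if "x \<in> free_on ?X" "y \<in> free_on ?X" for x y :: "_ \<Rightarrow>\<^sub>0 'k"
    using that by (rule free_on_add)
  moreover have "pm_scale (*) c x \<in> free_on ?X" if "x \<in> free_on ?X" for c :: 'k and x
    using that by (auto simp: free_on_def in_keys_iff)
  ultimately show ?thesis
    unfolding is_cotensor_mult_def Let_def coalgebra_map_def linear_on_free_def
    by (auto simp: thin_mult_closed thin_mult_add thin_mult_scale comult_thin_mult counit_thin_mult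
        tensor_in_free_on vertex_part_thin_mult arrow_part_thin_mult)
qed

text \<open>Induction on the list \<open>es\<close> of the path whose coefficient is compared, for
  all pairs of factors at once, because the comultiplication replaces the factors by their
  subpaths.\<close>

lemma is_cotensor_mult_unique:
  assumes f: "is_cotensor_mult scale lact ract E f" and g: "is_cotensor_mult scale lact ract E g"
  shows "f = g"
proof -
  let ?X = "paths Q \<times> paths Q"
  have closed: "h x \<in> free_on (paths Q)"
    if "is_cotensor_mult scale lact ract E h" "x \<in> free_on ?X" for h x
    using that unfolding is_cotensor_mult_def Let_def coalgebra_map_def by blast
  have lin: "linear_on_free ?X h" if "is_cotensor_mult scale lact ract E h" for h
    using that unfolding is_cotensor_mult_def Let_def coalgebra_map_def by blast
  have comult: "path_comult Q (h x) = tensor_map h h (tensor_comult (path_comult Q) (path_comult Q) x)"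
    if "is_cotensor_mult scale lact ract E h" "x \<in> free_on ?X" for h x
    using that unfolding is_cotensor_mult_def Let_def coalgebra_map_def by blast
  have vertex: "vertex_part (h (single (\<alpha>, \<beta>) 1)) = vertex_part (single \<alpha> 1) * vertex_part (single \<beta> 1)"
    and arrow: "arrow_part scale (h (single (\<alpha>, \<beta>) 1)) =
      lact (vertex_part (single \<alpha> 1)) (arrow_part scale (single \<beta> 1)) +
      ract (arrow_part scale (single \<alpha> 1)) (vertex_part (single \<beta> 1))"
    if h: "is_cotensor_mult scale lact ract E h" and ab: "\<alpha> \<in> paths Q" "\<beta> \<in> paths Q" for h \<alpha> \<beta>
  proof -
    have "single \<alpha> 1 \<in> free_on (paths Q)" "single \<beta> 1 \<in> free_on (paths Q)" using ab by (auto simp: free_on_def)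
    from h[unfolded is_cotensor_mult_def Let_def, THEN conjunct2, rule_format, OF this]
    show "vertex_part (h (single (\<alpha>, \<beta>) 1)) = vertex_part (single \<alpha> 1) * vertex_part (single \<beta> 1)"
      "arrow_part scale (h (single (\<alpha>, \<beta>) 1)) =
      lact (vertex_part (single \<alpha> 1)) (arrow_part scale (single \<beta> 1)) +
      ract (arrow_part scale (single \<alpha> 1)) (vertex_part (single \<beta> 1))" by simp_all
  qed
  have basis: "single a (1::'k) \<in> free_on ?X" if "a \<in> ?X" for a
    using that by (auto simp: free_on_def)
  have outside: "Poly_Mapping.lookup (h (single a 1)) \<gamma> = 0"
    if "is_cotensor_mult scale lact ract E h" "a \<in> ?X" "\<gamma> \<notin> paths Q" for h a \<gamma>
    using closed[OF that(1) basis[OF that(2)]] that(3) by (auto simp: free_on_def in_keys_iff)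
  have eq: "Poly_Mapping.lookup (f (single ((u, p), (v, q)) 1)) (w, es) =
      Poly_Mapping.lookup (g (single ((u, p), (v, q)) 1)) (w, es)"
    if "(u, p) \<in> paths Q" "(v, q) \<in> paths Q" for u p v q w es
    using that
  proof (induction es arbitrary: u p v q w)
    case Nil
    then show ?case using vertex[OF f] vertex[OF g] by (simp flip: lookup_vertex_part)
  next
    case (Cons e es)
    show ?case
    proof (cases "e \<in> arcs Q \<and> w = tail Q e")
      case False
      \<comment> \<open>Values lie in the span of the paths, so both coefficients are zero
        here.\<close>
      then have "(w, e # es) \<notin> paths Q" by (auto simp: paths_simps)
      then show ?thesis using outside f g Cons.prems by simp
    next
      case True
      \<comment> \<open>Cutting off the first traversed arrow leaves coefficients at
        \<open>[e]\<close>, prescribed by the component in B, and at the shorter \<open>es\<close>,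
        covered by the induction hypothesis.\<close>
      have split: "Poly_Mapping.lookup (h (single ((u, p), (v, q)) 1)) (w, e # es) =
        (\<Sum>i\<le>length p. \<Sum>j\<le>length q.
          Poly_Mapping.lookup (h (single ((u, take i p), (v, take j q)) 1)) (w, [e]) *
          Poly_Mapping.lookup (h (single ((target Q (u, take i p), drop i p),
            (target Q (v, take j q), drop j q)) 1)) (head Q e, es))"
        if h: "is_cotensor_mult scale lact ract E h" for h
      proof -
        have "Poly_Mapping.lookup (h (single ((u, p), (v, q)) 1)) (w, e # es) =
          Poly_Mapping.lookup (path_comult Q (h (single ((u, p), (v, q)) 1))) ((head Q e, es), (w, [e]))"
          by (simp add: lookup_path_comult)
        then show ?thesis
          using comult[OF h basis] Cons.prems by (simp add: lookup_tensor_map_path_comult)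
      qed
      have "Poly_Mapping.lookup (f (single ((u, take i p), (v, take j q)) 1)) (w, [e]) =
        Poly_Mapping.lookup (g (single ((u, take i p), (v, take j q)) 1)) (w, [e])" for i j
      proof -
        note P = paths_take_drop(1)[OF Cons.prems(1)] paths_take_drop(1)[OF Cons.prems(2)]
        have "Poly_Mapping.lookup (h (single ((u, take i p), (v, take j q)) 1)) (w, [e]) =
          rep (arrow_part scale (h (single ((u, take i p), (v, take j q)) 1))) e"
          if "is_cotensor_mult scale lact ract E h" for h
          using rep_arrow_part[OF closed[OF that basis]] P True by simp
        then show ?thesis using f g arrow[OF f P] arrow[OF g P] by simp
      qed
      then show ?thesis
        unfolding split[OF f] split[OF g]
        by (simp add: Cons.IH paths_take_drop(2)[OF Cons.prems(1)] paths_take_drop(2)[OF Cons.prems(2)])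
    qed
  qed
  have "f x = g x" if "x \<in> free_on ?X" for x
    using lin[OF f] lin[OF g] that
  proof (rule linear_on_free_ext)
    fix a assume "a \<in> ?X"
    then show "f (single a 1) = g (single a 1)"
      by (intro poly_mapping_eqI) (auto simp: split_paired_all eq)
  qed
  \<comment> \<open>Both maps take the default value outside \<open>free_on ?X\<close>, so they
    agree as functions, as the definite description in \<open>cotensor_mult\<close>
    requires.\<close>
  moreover have "f \<in> extensional (free_on ?X)" "g \<in> extensional (free_on ?X)"
    using f g unfolding is_cotensor_mult_def Let_def coalgebra_map_def PiE_def by blast+
  ultimately show "f = g" by (intro extensionalityI)
qed

lemma cotensor_mult_eq:
  "cotensor_mult scale lact ract E = restrict thin_mult (free_on (paths Q \<times> paths Q))"
  unfolding cotensor_mult_def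
  by (rule the_equality) (rule is_cotensor_mult_thin_mult is_cotensor_mult_unique; assumption?)+

end

theorem theorem3p8:
  fixes scale :: "'k::field \<Rightarrow> 'b::ab_group_add \<Rightarrow> 'b"
    and lact :: "('g::group_add \<Rightarrow>\<^sub>0 'k) \<Rightarrow> 'b \<Rightarrow> 'b"
    and ract :: "'b \<Rightarrow> ('g \<Rightarrow>\<^sub>0 'k) \<Rightarrow> 'b"
    and \<delta>\<^sub>L \<delta>\<^sub>R :: "'b \<Rightarrow> ('g \<Rightarrow>\<^sub>0 'b)"
    and E :: "'g \<Rightarrow> 'g \<Rightarrow> 'b set"
    and \<alpha> \<beta> :: "('g, 'b) path"
    and n m :: nat
  assumes "hopf_bimodule scale lact ract \<delta>\<^sub>L \<delta>\<^sub>R"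
    and "isotypic_bases scale \<delta>\<^sub>L \<delta>\<^sub>R E"
    and "\<alpha> \<in> paths_of_length (quiver E) n"
    and "\<beta> \<in> paths_of_length (quiver E) m"
  shows "cotensor_mult scale lact ract E (tensor (single \<alpha> 1) (single \<beta> 1)) =
    (\<Sum>d\<in>thin_seqs n (n + m). thin_product scale lact ract E \<alpha> \<beta> d)"
proof -
  interpret hopf_bimodule_bases scale lact ract \<delta>\<^sub>L \<delta>\<^sub>R E
    using assms(1,2) by (simp add: hopf_bimodule_bases_def hopf_bimodule_bases_axioms_def)
  have "\<alpha> \<in> paths Q" "\<beta> \<in> paths Q" "length (snd \<alpha>) = n" "length (snd \<beta>) = m"
    using assms(3,4) by (auto simp: paths_of_length_def)
  moreover have "pm_scale (*) (1::'k) x = x" for x :: "('g, 'b) path \<Rightarrow>\<^sub>0 'k"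
    by (rule poly_mapping_eqI) simp
  ultimately show ?thesis
    by (simp add: cotensor_mult_eq free_on_def thin_mult_single thin_sum_def)
qed

end
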